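(* Let $S = k[x_1,\ldots,x_r]$ be a polynomial ring in $r$ variables over a field $k$ and let $\mathfrak m=(x_1,\ldots,x_r)$ be the maximal homogeneous ideal of $S$. Let $P_1,\ldots,P_\alpha$, with $\alpha \geq 2$, be distinct ideals of $S$, each generated by a subset of $\{x_1,\ldots,x_r\}$. Let $I = \bigcap_{i=1}^\alpha P_i$, $R=S/I$, let $\mathfrak n = \mathfrak m/I$ be the maximal homogeneous ideal of $R$, and let $d=\dim(R)$. Suppose that $R$ is Cohen-Macaulay. Then the length $$\ell\left(\frac{\mathcal R(\mathfrak n)}{(\mathfrak n,\mathfrak n t)^{[s]}}\right)$$ is given by a polynomial for $s\ge 1$; that is, there is a polynomial $P(X)\in\mathbb{Q}[X]$ such that this length equals $P(s)$ for all integers $s\geq 1$.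
   Context: $\mathcal R(\mathfrak n)=\bigoplus_{n\ge 0}\mathfrak n^n t^n\subseteq R[t]$ is the Rees algebra of $\mathfrak n$, and $(\mathfrak n,\mathfrak n t)$ is its maximal homogeneous ideal. For an ideal $J=(a_1,\ldots,a_g)$ with a fixed set of generators, the $s$-th (generalized) Frobenius power is $J^{[s]}=(a_1^s,\ldots,a_g^s)$. Here $\mathfrak n$ is generated by the images of $x_1,\ldots,x_r$ in $R$, and $(\mathfrak n,\mathfrak n t)$ is generated by the images of $x_1,\ldots,x_r$ together with $x_1t,\ldots,x_rt$, so $(\mathfrak n,\mathfrak n t)^{[s]}$ is the ideal of $\mathcal R(\mathfrak n)$ generated by $x_1^s,\ldots,x_r^s,x_1^st^s,\ldots,x_r^st^s$. The function $s\mapsto \ell(\mathcal R(\mathfrak n)/(\mathfrak n,\mathfrak n t)^{[s]})$ is called the generalized Hilbert-Kunz function of $(\mathfrak n,\mathfrak n t)$; $\ell$ denotes length. *)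

theory Defs
  imports
    "HOL-Algebra.Algebra"
    "HOL-Decision_Procs.Algebra_Aux"
    "HOL-Library.Poly_Mapping"
    "HOL-Library.Extended_Nat"
    "HOL-Computational_Algebra.Polynomial"
begin

text \<open>
  A polynomial in the variables \<open>x\<^sub>i\<close>, \<open>i :: 'n\<close>, over \<open>'k\<close> is a finitely supported function
  from exponent vectors to coefficients; since \<open>'n\<close> is a finite type, the number of variables
  is \<open>CARD('n)\<close>. HOL-Library provides the ring operations on \<open>\<Rightarrow>\<^sub>0\<close> by type class;
  \<^const>\<open>cring_class_ops\<close> packs them into a ring record with carrier \<open>UNIV\<close>.
\<close>

type_synonym ('n, 'k) mpol = "('n \<Rightarrow>\<^sub>0 nat) \<Rightarrow>\<^sub>0 'k"

definition mpol_ring :: "('n::finite, 'k::field) mpol ring" where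
  "mpol_ring = cring_class_ops"

definition mpol_var :: "'n::finite \<Rightarrow> ('n, 'k::field) mpol" where
  "mpol_var i = Poly_Mapping.single (Poly_Mapping.single i 1) 1"


text \<open>
  The supremum of all \<open>n\<close> for which there is a strict chain
  \<open>C 0 \<subset> C 1 \<subset> \<dots> \<subset> C n\<close> of members of \<open>F\<close>.
\<close>

definition chain_sup :: "'a set set \<Rightarrow> enat" where
  "chain_sup F =
    Sup {enat n | n. \<exists>C :: nat \<Rightarrow> 'a set. (\<forall>i\<le>n. C i \<in> F) \<and> (\<forall>i<n. C i \<subset> C (Suc i))}"

definition krull_dim :: "('a, 'b) ring_scheme \<Rightarrow> enat" where
  "krull_dim A = chain_sup {p. primeideal p A}"

definition height :: "('a, 'b) ring_scheme \<Rightarrow> 'a set \<Rightarrow> enat" where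
  "height A p = chain_sup {q. primeideal q A \<and> q \<subseteq> p}"

definition module_length ::
    "('a, 'b) ring_scheme \<Rightarrow> ('a, 'c, 'd) module_scheme \<Rightarrow> enat" where
  "module_length A M = chain_sup {N. submodule N A M}"

definition quotient_module :: "('a, 'b) ring_scheme \<Rightarrow> 'a set \<Rightarrow> ('a, 'a set) module" where
  "quotient_module A J =
    \<lparr>carrier = carrier (A Quot J), monoid.mult = monoid.mult (A Quot J),
     one = one (A Quot J), ring.zero = ring.zero (A Quot J), add = add (A Quot J),
     module.smult = (\<lambda>a. monoid.mult (A Quot J) (J +>\<^bsub>A\<^esub> a))\<rparr>"


text \<open>
  \<open>xs\<close> generates a proper ideal, and each \<open>xs ! i\<close> is a nonzerodivisor modulo the ideal
  generated by its predecessors.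
\<close>

definition regular_sequence :: "('a, 'b) ring_scheme \<Rightarrow> 'a list \<Rightarrow> bool" where
  "regular_sequence A xs \<longleftrightarrow>
    set xs \<subseteq> carrier A \<and> Idl\<^bsub>A\<^esub> (set xs) \<noteq> carrier A \<and>
    (\<forall>i<length xs. \<forall>a\<in>carrier A.
       xs ! i \<otimes>\<^bsub>A\<^esub> a \<in> Idl\<^bsub>A\<^esub> (set (take i xs)) \<longrightarrow> a \<in> Idl\<^bsub>A\<^esub> (set (take i xs)))"

definition depth :: "('a, 'b) ring_scheme \<Rightarrow> 'a set \<Rightarrow> enat" where
  "depth A J = Sup {enat (length xs) | xs. regular_sequence A xs \<and> set xs \<subseteq> J}"

text \<open>
  Cohen-Macaulay rings as in Eisenbud, Commutative Algebra, Section 18.2 (and Kaplansky,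
  Commutative Rings, Section 3-1). For a maximal ideal \<open>p\<close> of a Noetherian ring \<open>A\<close> one has
  \<open>depth A p = depth A\<^sub>p\<close> and \<open>height A p = dim A\<^sub>p\<close>, so this says that every localization of
  \<open>A\<close> at a maximal ideal is a Cohen-Macaulay local ring.
\<close>

definition cohen_macaulay :: "('a, 'b) ring_scheme \<Rightarrow> bool" where
  "cohen_macaulay A \<longleftrightarrow>
    cring A \<and> noetherian_ring A \<and> (\<forall>p. maximalideal p A \<longrightarrow> depth A p = height A p)"


text \<open>
  The Rees algebra as the subring of \<open>A[t]\<close> of polynomials whose coefficient of \<open>t\<^sup>j\<close> lies in
  \<open>J\<^sup>j\<close>; the power is taken in the multiplicative monoid of ideals, so \<open>J\<^sup>0\<close> is the unit ideal.
\<close>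

definition rees_algebra :: "('a, 'b) ring_scheme \<Rightarrow> 'a set \<Rightarrow> ('a, nat \<Rightarrow> 'a) up_ring" where
  "rees_algebra A J =
    (UP A)\<lparr>carrier := {p \<in> carrier (UP A). \<forall>j. up_ring.coeff (UP A) p j \<in> J [^]\<^bsub>ideals_set A\<^esub> j}\<rparr>"

text \<open>The generalized Frobenius power depends on the set \<open>G\<close> of generators, not only on the
  ideal generated by \<open>G\<close>.\<close>

definition frobenius_power :: "('a, 'b) ring_scheme \<Rightarrow> 'a set \<Rightarrow> nat \<Rightarrow> 'a set" where
  "frobenius_power A G s = Idl\<^bsub>A\<^esub> ((\<lambda>a. a [^]\<^bsub>A\<^esub> s) ` G)"

end

theory Submission
  imports Defs "HOL-Library.Product_Plus"
begin

text \<open>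
  The ideal \<open>I\<close> is the Stanley-Reisner ideal of the simplicial complex \<open>\<Delta>\<close> whose faces are the sets of
  variables that avoid the generators of some \<open>P\<^sub>i\<close>. So \<open>R\<close> has a \<open>k\<close>-basis of the monomials \<open>x\<^sup>a\<close> with
  support in \<open>\<Delta>\<close>, the power \<open>\<nn>\<^sup>j\<close> is spanned by those of degree at least \<open>j\<close>, and the Rees algebra has
  the basis \<open>x\<^sup>a t\<^sup>j\<close> with \<open>supp a \<in> \<Delta>\<close> and \<open>j \<le> \<bar>a\<bar>\<close>. The Frobenius power is generated by monomials,
  hence is itself spanned by monomials: it contains \<open>x\<^sup>a t\<^sup>j\<close> iff \<open>a\<^sub>i \<ge> s\<close> for some \<open>i\<close> with
  \<open>j \<ge> s\<close> or \<open>j + s \<le> \<bar>a\<bar>\<close>. Only finitely many monomials lie outside it.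

  The length of the quotient is the number of these remaining monomials (\<open>chain_sup_ideals\<close>). In one
  direction, ideals are \<open>k\<close>-subspaces, so a strict chain of ideals has at most as many steps as the
  dimension. In the other, adjoining the monomials one at a time by decreasing degree gives a chain of
  ideals of that length.

  The count is done for each face \<open>F\<close> separately (\<open>card_frobenius_complement\<close>). With \<open>f = \<bar>F\<bar>\<close>, the
  exponents \<open>a\<close> of support \<open>F\<close> with all \<open>a\<^sub>i < s\<close> contribute \<open>\<Sum> (\<bar>a\<bar> + 1) = f s (s - 1)\<^sup>f / 2 + (s - 1)\<^sup>f\<close>
  basis elements, and for each \<open>i \<in> F\<close> the pairs with \<open>a\<^sub>i \<ge> s\<close> contribute \<open>s choose (f + 1)\<close>. Both are
  polynomials in \<open>s\<close> for \<open>s \<ge> 1\<close>.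

  The locale \<open>monomial_ring\<close> carries the first part: it is stable under passing to quotients by
  monomial ideals (\<open>monomial_ring_quotient\<close>) and to Rees algebras (\<open>monomial_ring_rees\<close>), so that
  starting from the polynomial ring it reaches the ring whose length is wanted.
\<close>

section \<open>Ideals and module length\<close>

lemma (in cring) ideal_iff:
  "ideal N R \<longleftrightarrow> N \<subseteq> carrier R \<and> \<zero> \<in> N \<and> (\<forall>x\<in>N. \<forall>y\<in>N. x \<oplus> y \<in> N) \<and>
     (\<forall>a\<in>carrier R. \<forall>x\<in>N. a \<otimes> x \<in> N)" (is "_ \<longleftrightarrow> ?rhs")
proof
  assume "ideal N R"
  then interpret ideal N R .
  show ?rhs using a_subset by (auto intro: I_l_closed)
next
  assume rhs: ?rhs
  have "\<ominus> x \<in> N" if "x \<in> N" for x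
  proof -
    have "\<ominus> x = (\<ominus> \<one>) \<otimes> x" using that rhs by (auto simp: l_minus)
    then show ?thesis using that rhs by auto
  qed
  then have "subgroup N (add_monoid R)"
    using rhs by (intro add.subgroupI) auto
  moreover have "a \<otimes> x \<in> N" if "a \<in> N" "x \<in> carrier R" for a x
    using that rhs m_comm[of a x] by auto
  ultimately show "ideal N R"
    using rhs by (intro idealI ring_axioms) auto
qed

lemma (in cring) submodule_quotient_module_iff:
  assumes "ideal J R"
  shows "submodule N R (quotient_module R J) \<longleftrightarrow> ideal N (R Quot J)"
proof -
  interpret J: ideal J R by fact
  interpret Q: cring "R Quot J" by (rule J.quotient_is_cring) (rule is_cring)
  have carr: "carrier (R Quot J) = (+>) J ` carrier R"
    by (auto simp: FactRing_def A_RCOSETS_def')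
  have group: "subgroup N (add_monoid (quotient_module R J)) = subgroup N (add_monoid (R Quot J))"
    by (simp add: subgroup_def m_inv_def quotient_module_def)
  have smult: "a \<odot>\<^bsub>quotient_module R J\<^esub> x = (J +> a) \<otimes>\<^bsub>R Quot J\<^esub> x" for a x
    by (simp add: quotient_module_def)
  have sub: "submodule N R (quotient_module R J) \<longleftrightarrow> subgroup N (add_monoid (R Quot J)) \<and>
      (\<forall>a\<in>carrier R. \<forall>x\<in>N. (J +> a) \<otimes>\<^bsub>R Quot J\<^esub> x \<in> N)"
    unfolding submodule_def submodule_axioms_def group smult by blast
  show ?thesis
  proof
    assume "submodule N R (quotient_module R J)"
    then have N: "subgroup N (add_monoid (R Quot J))"
      and smult: "\<forall>a\<in>carrier R. \<forall>x\<in>N. (J +> a) \<otimes>\<^bsub>R Quot J\<^esub> x \<in> N"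
      unfolding sub by blast+
    show "ideal N (R Quot J)"
      unfolding Q.ideal_iff carr
      using subgroup.subset[OF N] subgroup.one_closed[OF N] subgroup.m_closed[OF N] smult
      by (simp add: carr)
  next
    assume "ideal N (R Quot J)"
    then interpret N: ideal N "R Quot J" .
    show "submodule N R (quotient_module R J)"
      unfolding sub using N.a_subgroup N.I_l_closed by (auto simp: carr)
  qed
qed

text \<open>
  The ring acts on \<open>R/J\<close> through \<open>R \<rightarrow> R/J\<close>, so the submodules are the ideals of the ring \<open>R/J\<close>.
  This removes modules from the rest of the argument.
\<close>

lemma (in cring) module_length_quotient_module:
  assumes "ideal J R"
  shows "module_length R (quotient_module R J) = chain_sup {N. ideal N (R Quot J)}"
  by (simp add: module_length_def submodule_quotient_module_iff[OF assms])

section \<open>Rings with a basis of monomials\<close>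

text \<open>
  A \<open>k\<close>-algebra in which the terms \<open>\<tau> b 1\<close>, \<open>b \<in> D\<close>, form a \<open>k\<close>-basis and multiply by adding
  indices, with product \<open>0\<close> when the sum leaves \<open>D\<close>; \<open>\<kappa> b\<close> reads off the coordinate at \<open>b\<close>. The polynomial ring, its Stanley-Reisner quotients, their Rees algebras and
  the quotients of these by monomial ideals all have this form, and monomial ideals are understood
  through their index sets alone. The product is described only by the support condition
  \<open>coord_mult\<close> and by the product of two terms; by bilinearity they determine it, and they carry over
  to quotients and Rees algebras more easily than a convolution formula. The grading \<open>\<delta>\<close> vanishes only at the unit; this makes divisibility of
  indices well-founded.
\<close>

locale monomial_ring = cring A for A (structure) +
  fixes D :: "'i::comm_monoid_add set"
    and \<kappa> :: "'i \<Rightarrow> 'a \<Rightarrow> 'k::field"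
    and \<tau> :: "'i \<Rightarrow> 'k \<Rightarrow> 'a"
    and \<delta> :: "'i \<Rightarrow> nat"
  assumes zero_index: "0 \<in> D"
    and term_closed: "b \<in> D \<Longrightarrow> \<tau> b c \<in> carrier A"
    and coord_term: "b \<in> D \<Longrightarrow> b' \<in> D \<Longrightarrow> \<kappa> b' (\<tau> b c) = (if b' = b then c else 0)"
    and coord_add: "x \<in> carrier A \<Longrightarrow> y \<in> carrier A \<Longrightarrow> b \<in> D \<Longrightarrow> \<kappa> b (x \<oplus> y) = \<kappa> b x + \<kappa> b y"
    and coord_eqI: "x \<in> carrier A \<Longrightarrow> y \<in> carrier A \<Longrightarrow> (\<And>b. b \<in> D \<Longrightarrow> \<kappa> b x = \<kappa> b y) \<Longrightarrow> x = y"
    and finite_support: "x \<in> carrier A \<Longrightarrow> finite {b \<in> D. \<kappa> b x \<noteq> 0}"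
    and coord_mult: "x \<in> carrier A \<Longrightarrow> y \<in> carrier A \<Longrightarrow> b \<in> D \<Longrightarrow> \<kappa> b (x \<otimes> y) \<noteq> 0 \<Longrightarrow>
          \<exists>b1\<in>D. \<exists>b2\<in>D. b = b1 + b2 \<and> \<kappa> b1 x \<noteq> 0 \<and> \<kappa> b2 y \<noteq> 0"
    and term_mult: "b1 \<in> D \<Longrightarrow> b2 \<in> D \<Longrightarrow> b1 + b2 \<in> D \<Longrightarrow> \<tau> b1 c1 \<otimes> \<tau> b2 c2 = \<tau> (b1 + b2) (c1 * c2)"
    and deg_add: "\<delta> (b1 + b2) = \<delta> b1 + \<delta> b2"
    and deg_zero: "b \<in> D \<Longrightarrow> \<delta> b = 0 \<Longrightarrow> b = 0"
begin

lemma coord_zero: "b \<in> D \<Longrightarrow> \<kappa> b \<zero> = 0"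
proof -
  assume "b \<in> D"
  then have "\<kappa> b \<zero> + \<kappa> b \<zero> = \<kappa> b \<zero> + 0" using coord_add[of \<zero> \<zero> b] by simp
  then show ?thesis by (simp only: add_left_cancel)
qed

lemma coord_finsum:
  assumes "finite Z" "f \<in> Z \<rightarrow> carrier A" "b \<in> D"
  shows "\<kappa> b (\<Oplus>i\<in>Z. f i) = (\<Sum>i\<in>Z. \<kappa> b (f i))"
  using assms
proof (induction Z rule: finite_induct)
  case empty
  then show ?case by (simp add: coord_zero)
next
  case (insert i Z)
  then show ?case by (simp add: coord_add Pi_def finsum_insert)
qed

text \<open>
  Every element is the sum of its finitely many terms, so a property that is closed under sums need
  only be checked on the terms at indices in the support of the element.
\<close>

lemma term_induct [consumes 1, case_names zero add monomial]:
  assumes x: "x \<in> carrier A"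
    and zero: "P \<zero>"
    and add: "\<And>x y. x \<in> carrier A \<Longrightarrow> y \<in> carrier A \<Longrightarrow> P x \<Longrightarrow> P y \<Longrightarrow> P (x \<oplus> y)"
    and terms: "\<And>b c. b \<in> D \<Longrightarrow> \<kappa> b x \<noteq> 0 \<Longrightarrow> P (\<tau> b c)"
  shows "P x"
proof -
  have "P y" if "y \<in> carrier A" "{b \<in> D. \<kappa> b y \<noteq> 0} \<subseteq> {b \<in> D. \<kappa> b x \<noteq> 0}" for y
    using that
  proof (induction "card {b \<in> D. \<kappa> b y \<noteq> 0}" arbitrary: y rule: less_induct)
    case less
    show ?case
    proof (cases "\<exists>b\<in>D. \<kappa> b y \<noteq> 0")
      case False
      then have "y = \<zero>" using less.prems by (intro coord_eqI) (auto simp: coord_zero)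
      then show ?thesis using zero by simp
    next
      case True
      then obtain b where b: "b \<in> D" "\<kappa> b y \<noteq> 0" by blast
      (* subtract the term at b: the support loses exactly b *)
      define z where "z = y \<oplus> \<tau> b (- \<kappa> b y)"
      have z: "z \<in> carrier A" using less.prems b by (simp add: z_def term_closed)
      have coord: "\<kappa> b' z = (if b' = b then 0 else \<kappa> b' y)" if "b' \<in> D" for b'
        using that b less.prems by (simp add: z_def coord_add coord_term term_closed)
      have "{b \<in> D. \<kappa> b z \<noteq> 0} \<subset> {b \<in> D. \<kappa> b y \<noteq> 0}"
      proof
        show "{b \<in> D. \<kappa> b z \<noteq> 0} \<subseteq> {b \<in> D. \<kappa> b y \<noteq> 0}" using coord by (auto split: if_splits)
        have "b \<in> {b \<in> D. \<kappa> b y \<noteq> 0}" "b \<notin> {b \<in> D. \<kappa> b z \<noteq> 0}" using b coord by auto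
        then show "{b \<in> D. \<kappa> b z \<noteq> 0} \<noteq> {b \<in> D. \<kappa> b y \<noteq> 0}" by metis
      qed
      then have "P z"
        using less.prems z psubset_card_mono[OF finite_support[OF less.prems(1)]]
        by (intro less.hyps) auto
      moreover have "P (\<tau> b (\<kappa> b y))" using b less.prems by (intro terms) auto
      moreover have "y = z \<oplus> \<tau> b (\<kappa> b y)"
        using less.prems b z by (intro coord_eqI) (auto simp: coord coord_add coord_term term_closed)
      ultimately show ?thesis using add z b by (metis term_closed)
    qed
  qed
  then show ?thesis using x by blast
qed

lemma coord_scalar_mult:
  assumes "x \<in> carrier A" "b \<in> D"
  shows "\<kappa> b (\<tau> 0 c \<otimes> x) = c * \<kappa> b x"
  using assms(1)
proof (induction rule: term_induct)
  case zero
  then show ?case using assms by (simp add: coord_zero zero_index term_closed)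
next
  case (add x y)
  then show ?case using assms by (simp add: coord_add zero_index term_closed r_distr distrib_left)
next
  case (monomial b' c')
  then show ?case using assms term_mult[OF zero_index, of b' c c'] by (simp add: coord_term)
qed

section \<open>Monomial ideals\<close>

definition monomial_ideal :: "'i set \<Rightarrow> 'a set" where
  "monomial_ideal E = {x \<in> carrier A. \<forall>b\<in>D - E. \<kappa> b x = 0}"

text \<open>Index sets of the terms of an ideal: multiplying by a term cannot leave the set.\<close>

definition absorbing :: "'i set \<Rightarrow> bool" where
  "absorbing E \<longleftrightarrow> (\<forall>b1\<in>D. \<forall>b2\<in>D. b1 + b2 \<in> D \<longrightarrow> b2 \<in> E \<longrightarrow> b1 + b2 \<in> E)"

lemma ideal_monomial_ideal:
  assumes "absorbing E"
  shows "ideal (monomial_ideal E) A"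
  unfolding ideal_iff
proof (intro conjI ballI)
  fix a x assume a: "a \<in> carrier A" and x: "x \<in> monomial_ideal E"
  have "\<kappa> b (a \<otimes> x) = 0" if b: "b \<in> D - E" for b
  proof (rule ccontr)
    assume "\<kappa> b (a \<otimes> x) \<noteq> 0"
    then obtain b1 b2 where *: "b1 \<in> D" "b2 \<in> D" "b = b1 + b2" "\<kappa> b2 x \<noteq> 0"
      using coord_mult[of a x b] a x b by (auto simp: monomial_ideal_def)
    then have "b2 \<in> E" using x by (auto simp: monomial_ideal_def)
    then show False using * b assms by (auto simp: absorbing_def)
  qed
  then show "a \<otimes> x \<in> monomial_ideal E" using a x by (simp add: monomial_ideal_def)
qed (auto simp: monomial_ideal_def coord_zero coord_add)

text \<open>
  If the generators lie in the monomial ideal and every index in \<open>E\<close> is a multiple of the index of a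
  generating term, then all terms of an element of the monomial ideal are generated.
  Generators that vanish in \<open>A\<close> are harmless here; they occur for variables that are not vertices of
  the simplicial complex.
\<close>

lemma genideal_eq_monomial_ideal:
  assumes E: "absorbing E" and S: "S \<subseteq> monomial_ideal E"
    and gen: "\<And>b. b \<in> D \<Longrightarrow> b \<in> E \<Longrightarrow> \<exists>g\<in>D. \<exists>d\<in>D. b = g + d \<and> \<tau> g 1 \<in> S"
  shows "Idl S = monomial_ideal E"
proof
  show "Idl S \<subseteq> monomial_ideal E"
    using ideal_monomial_ideal[OF E] S by (rule genideal_minimal)
  have Scarr: "S \<subseteq> carrier A" using S by (auto simp: monomial_ideal_def)
  interpret I: ideal "Idl S" A using Scarr by (rule genideal_ideal)
  show "monomial_ideal E \<subseteq> Idl S"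
  proof
    fix x assume x: "x \<in> monomial_ideal E"
    then have "x \<in> carrier A" by (simp add: monomial_ideal_def)
    then show "x \<in> Idl S"
    proof (induction rule: term_induct)
      case (monomial b c)
      then have "b \<in> E" using x by (auto simp: monomial_ideal_def)
      then obtain g d where gd: "g \<in> D" "d \<in> D" "b = g + d" "\<tau> g 1 \<in> S" using gen monomial by blast
      then have "\<tau> g 1 \<otimes> \<tau> d c \<in> Idl S"
        using genideal_self[OF Scarr] by (auto intro!: I.I_r_closed term_closed)
      then show ?case using gd monomial by (simp add: term_mult)
    qed auto
  qed
qed

text \<open>
  Modulo a monomial ideal, the terms outside the ideal remain a basis. The coordinate of a coset at
  such an index is that of any representative, because the elements of the ideal have coordinate \<open>0\<close>
  there; hence the choice of a representative in the coordinate function.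
\<close>

lemma monomial_ring_quotient:
  assumes E: "absorbing E" and "0 \<notin> E"
  shows "monomial_ring (A Quot monomial_ideal E) (D - E)
           (\<lambda>b Z. \<kappa> b (SOME x. x \<in> Z)) (\<lambda>b c. monomial_ideal E +> \<tau> b c) \<delta>"
    and "\<And>x b. x \<in> carrier A \<Longrightarrow> b \<in> D - E \<Longrightarrow>
           \<kappa> b (SOME y. y \<in> monomial_ideal E +> x) = \<kappa> b x"
proof -
  let ?I = "monomial_ideal E"
  have mem_ideal: "h \<in> carrier A \<and> (\<forall>b\<in>D - E. \<kappa> b h = 0)" if "h \<in> ?I" for h
    using that by (simp add: monomial_ideal_def)
  have mem_idealI: "h \<in> ?I" if "h \<in> carrier A" "\<And>b. b \<in> D - E \<Longrightarrow> \<kappa> b h = 0" for h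
    using that by (simp add: monomial_ideal_def)
  interpret I: ideal ?I A using E by (rule ideal_monomial_ideal)
  interpret Q: cring "A Quot ?I" by (rule I.quotient_is_cring) (rule is_cring)
  have rep: "\<kappa> b (SOME y. y \<in> ?I +> x) = \<kappa> b x" if xb: "x \<in> carrier A" "b \<in> D - E" for x b
  proof -
    have coset: "\<kappa> b z = \<kappa> b x" if z: "z \<in> ?I +> x" for z
    proof -
      obtain h where h: "h \<in> ?I" "z = h \<oplus> x" using z by (auto simp: a_r_coset_def')
      then show ?thesis
        using xb mem_ideal[OF h(1)] by (simp add: coord_add)
    qed
    show ?thesis using I.a_rcos_self[OF xb(1)] by (rule coset[OF someI])
  qed
  have carr: "carrier (A Quot ?I) = (+>) ?I ` carrier A"
    by (auto simp: FactRing_def A_RCOSETS_def')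
  have add: "(?I +> x) \<oplus>\<^bsub>A Quot ?I\<^esub> (?I +> y) = ?I +> (x \<oplus> y)" 
    if "x \<in> carrier A" "y \<in> carrier A" for x y
    using that by (simp add: FactRing_def I.a_rcos_sum)
  have mult: "(?I +> x) \<otimes>\<^bsub>A Quot ?I\<^esub> (?I +> y) = ?I +> (x \<otimes> y)" 
    if "x \<in> carrier A" "y \<in> carrier A" for x y
    using that by (simp add: FactRing_def I.rcoset_mult_add)
  show "monomial_ring (A Quot ?I) (D - E)
           (\<lambda>b Z. \<kappa> b (SOME x. x \<in> Z)) (\<lambda>b c. ?I +> \<tau> b c) \<delta>"
  proof (intro monomial_ring.intro Q.is_cring monomial_ring_axioms.intro)
    fix Z Y assume "Z \<in> carrier (A Quot ?I)" "Y \<in> carrier (A Quot ?I)"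
      and eq: "\<And>b. b \<in> D - E \<Longrightarrow> \<kappa> b (SOME x. x \<in> Z) = \<kappa> b (SOME x. x \<in> Y)"
    then obtain x y where xy: "x \<in> carrier A" "y \<in> carrier A" "Z = ?I +> x" "Y = ?I +> y"
      by (auto simp: carr)
    have "\<kappa> b (x \<ominus> y) = 0" if "b \<in> D - E" for b
    proof -
      have "\<kappa> b (x \<ominus> y) + \<kappa> b y = \<kappa> b x"
        using that xy coord_add[of "x \<ominus> y" y b] by (simp add: a_minus_def a_assoc l_neg)
      then show ?thesis using eq[OF that] that xy by (simp add: rep)
    qed
    then have "x \<ominus> y \<in> ?I" using xy by (intro mem_idealI) simp_all
    then show "Z = Y"
      using xy by (simp add: quotient_eq_iff_same_a_r_cos[OF I.ideal_axioms])
  next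
    fix Z Y b assume "Z \<in> carrier (A Quot ?I)" "Y \<in> carrier (A Quot ?I)" and b: "b \<in> D - E"
      and nz: "\<kappa> b (SOME x. x \<in> Z \<otimes>\<^bsub>A Quot ?I\<^esub> Y) \<noteq> 0"
    then obtain x y where xy: "x \<in> carrier A" "y \<in> carrier A" "Z = ?I +> x" "Y = ?I +> y"
      by (auto simp: carr)
    then have "\<kappa> b (x \<otimes> y) \<noteq> 0" using nz b by (simp add: mult rep)
    then obtain b1 b2 where *: "b1 \<in> D" "b2 \<in> D" "b = b1 + b2" "\<kappa> b1 x \<noteq> 0" "\<kappa> b2 y \<noteq> 0"
      using coord_mult xy b by blast
    moreover have "b2 \<notin> E" using * b E by (auto simp: absorbing_def)
    moreover have "b1 \<notin> E"
      using *(1,2) b E unfolding \<open>b = b1 + b2\<close> add.commute[of b1 b2] absorbing_def by blast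
    ultimately show "\<exists>b1\<in>D - E. \<exists>b2\<in>D - E. b = b1 + b2 \<and>
        \<kappa> b1 (SOME x. x \<in> Z) \<noteq> 0 \<and> \<kappa> b2 (SOME x. x \<in> Y) \<noteq> 0"
      using xy by (auto simp: rep)
  next
    fix Z assume "Z \<in> carrier (A Quot ?I)"
    then obtain x where x: "x \<in> carrier A" "Z = ?I +> x" by (auto simp: carr)
    have "{b \<in> D - E. \<kappa> b (SOME x. x \<in> Z) \<noteq> 0} \<subseteq> {b \<in> D. \<kappa> b x \<noteq> 0}"
      using x by (auto simp: rep)
    then show "finite {b \<in> D - E. \<kappa> b (SOME x. x \<in> Z) \<noteq> 0}"
      using finite_support[OF x(1)] by (rule finite_subset)
  next
    show "0 \<in> D - E" using assms zero_index by blast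
  next
    fix b c assume "b \<in> D - E"
    then show "?I +> \<tau> b c \<in> carrier (A Quot ?I)" by (auto simp: carr term_closed)
  next
    fix b b' c assume "b \<in> D - E" "b' \<in> D - E"
    then show "\<kappa> b' (SOME x. x \<in> ?I +> \<tau> b c) = (if b' = b then c else 0)"
      by (simp add: rep coord_term term_closed)
  next
    fix Z Y b assume "Z \<in> carrier (A Quot ?I)" "Y \<in> carrier (A Quot ?I)" and b: "b \<in> D - E"
    then obtain x y where "x \<in> carrier A" "y \<in> carrier A" "Z = ?I +> x" "Y = ?I +> y"
      by (auto simp: carr)
    then show "\<kappa> b (SOME x. x \<in> Z \<oplus>\<^bsub>A Quot ?I\<^esub> Y) = \<kappa> b (SOME x. x \<in> Z) + \<kappa> b (SOME x. x \<in> Y)"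
      using b by (simp add: rep add coord_add)
  next
    fix b1 b2 c1 c2 assume "b1 \<in> D - E" "b2 \<in> D - E" "b1 + b2 \<in> D - E"
    then show "(?I +> \<tau> b1 c1) \<otimes>\<^bsub>A Quot ?I\<^esub> (?I +> \<tau> b2 c2) = ?I +> \<tau> (b1 + b2) (c1 * c2)"
      by (simp add: mult term_closed term_mult)
  next
    show "\<delta> (b1 + b2) = \<delta> b1 + \<delta> b2" for b1 b2 by (rule deg_add)
  next
    show "b = 0" if "b \<in> D - E" "\<delta> b = 0" for b using that deg_zero by blast
  qed
  show "\<And>x b. x \<in> carrier A \<Longrightarrow> b \<in> D - E \<Longrightarrow> \<kappa> b (SOME y. y \<in> ?I +> x) = \<kappa> b x"
    by (rule rep)
qed

end

section \<open>Length of a ring with a finite basis of monomials\<close>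

lemma finite_enumeration_sorted_by:
  fixes f :: "'b \<Rightarrow> nat"
  assumes "finite B"
  shows "\<exists>e. bij_betw e {..<card B} B \<and> (\<forall>i j. i \<le> j \<longrightarrow> j < card B \<longrightarrow> f (e i) \<le> f (e j))"
proof -
  obtain xs where xs: "set xs = B" "distinct xs" using finite_distinct_list[OF assms] by blast
  define ys where "ys = sort_key f xs"
  have ys: "set ys = B" "distinct ys" "sorted (map f ys)" using xs by (simp_all add: ys_def)
  have len: "length ys = card B" using ys(1) distinct_card[OF ys(2)] by simp
  have "bij_betw ((!) ys) {..<card B} B"
    by (rule bij_betw_nth) (simp_all only: ys len)
  moreover have "f (ys ! i) \<le> f (ys ! j)" if "i \<le> j" "j < card B" for i j
    using sorted_nth_mono[OF ys(3), of i j] that by (simp add: len)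
  ultimately show ?thesis by blast
qed

lemma strict_subset_chain_le_card:
  assumes "finite F" "\<And>i. i \<le> n \<Longrightarrow> L i \<subseteq> F" "\<And>i. i < n \<Longrightarrow> L i \<subset> L (Suc i)"
  shows "n \<le> card F"
proof -
  have "i \<le> card (L i)" if "i \<le> n" for i
    using that
  proof (induction i)
    case (Suc i)
    then have "card (L i) < card (L (Suc i))"
      using assms by (intro psubset_card_mono finite_subset[OF _ assms(1)]) auto
    then show ?case using Suc by simp
  qed simp
  then have "n \<le> card (L n)" by simp
  also have "\<dots> \<le> card F" using assms by (intro card_mono) auto
  finally show ?thesis .
qed

context monomial_ring
begin

text \<open>
  The positions, in the enumeration \<open>e\<close> of the basis, of the first nonzero coordinates of the elements
  of \<open>N\<close>.
\<close>

definition leading :: "(nat \<Rightarrow> 'i) \<Rightarrow> nat \<Rightarrow> 'a set \<Rightarrow> nat set" where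
  "leading e n N = {i. i < n \<and> (\<exists>x\<in>N. \<kappa> (e i) x \<noteq> 0 \<and> (\<forall>j<i. \<kappa> (e j) x = 0))}"

lemma leading_mono: "N \<subseteq> N' \<Longrightarrow> leading e n N \<subseteq> leading e n N'"
  by (auto simp: leading_def)

text \<open>
  Gaussian elimination: an element of \<open>N'\<close> has the same leading position as some element of \<open>N\<close>, and
  subtracting a scalar multiple of the latter moves the leading position further. As the basis is
  finite, this ends with \<open>0\<close>.
\<close>

lemma ideal_eq_if_leading_subset:
  assumes "ideal N A" "ideal N' A" "N \<subseteq> N'"
    and e: "bij_betw e {..<n} D"
    and lead: "leading e n N' \<subseteq> leading e n N"
  shows "N = N'"
proof -
  interpret N: ideal N A by fact
  interpret N': ideal N' A by fact
  have eD: "e i \<in> D" if "i < n" for i using e that by (auto simp: bij_betw_def)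
  (* m is the number of final positions at which x may still be nonzero *)
  have "\<forall>x\<in>N'. (\<forall>j<n - m. \<kappa> (e j) x = 0) \<longrightarrow> x \<in> N" if "m \<le> n" for m
    using that
  proof (induction m)
    case 0
    show ?case
    proof (intro ballI impI)
      fix x assume x: "x \<in> N'" "\<forall>j<n - 0. \<kappa> (e j) x = 0"
      have "\<kappa> b x = 0" if "b \<in> D" for b
        using e that x by (auto simp: bij_betw_def)
      then have "x = \<zero>" using x by (intro coord_eqI) (auto simp: coord_zero)
      then show "x \<in> N" by simp
    qed
  next
    case (Suc m)
    define k where "k = n - Suc m"
    have k: "k < n" "n - m = Suc k" using Suc.prems by (auto simp: k_def)
    show ?case
    proof (intro ballI impI)
      fix x assume x: "x \<in> N'" "\<forall>j<n - Suc m. \<kappa> (e j) x = 0"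
      show "x \<in> N"
      proof (cases "\<kappa> (e k) x = 0")
        case True
        then have "\<forall>j<n - m. \<kappa> (e j) x = 0" using x k by (auto simp: k_def less_Suc_eq)
        then show ?thesis using Suc x by simp
      next
        case False
        then have "k \<in> leading e n N'" using x k by (auto simp: leading_def k_def)
        then obtain y where y: "y \<in> N" "\<kappa> (e k) y \<noteq> 0" "\<forall>j<k. \<kappa> (e j) y = 0"
          using lead by (auto simp: leading_def)
        define z where "z = \<tau> 0 (\<kappa> (e k) x / \<kappa> (e k) y) \<otimes> y"
        have z: "z \<in> N" using y by (simp add: z_def N.I_l_closed term_closed zero_index)
        have zc: "\<kappa> (e j) z = \<kappa> (e k) x / \<kappa> (e k) y * \<kappa> (e j) y" if "j < n" for j
          using y eD[OF that] by (simp add: z_def coord_scalar_mult)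
        have w: "x \<ominus> z \<in> N'" using x z assms(3) by (auto simp: a_minus_def)
        have wz: "x \<ominus> z \<oplus> z = x" using x z by (simp add: a_minus_def a_assoc l_neg)
        have "\<kappa> (e j) (x \<ominus> z) = 0" if j: "j < n - m" for j
        proof -
          have "j < n" using j by simp
          then have "\<kappa> (e j) (x \<ominus> z) + \<kappa> (e j) z = \<kappa> (e j) x"
            using coord_add[of "x \<ominus> z" z "e j"] w z eD wz by simp
          moreover have "\<kappa> (e j) z = \<kappa> (e j) x"
            using j k x y zc[OF \<open>j < n\<close>] by (auto simp: less_Suc_eq k_def)
          ultimately show ?thesis by simp
        qed
        then have "x \<ominus> z \<in> N" using Suc w by simp
        then show ?thesis using wz z N.a_closed by metis
      qed
    qed
  qed
  from this[of n] show ?thesis using assms(3) by auto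
qed

lemma monomial_ideal_mono: "E \<subseteq> E' \<Longrightarrow> monomial_ideal E \<subseteq> monomial_ideal E'"
  by (auto simp: monomial_ideal_def)

lemma term_in_monomial_ideal: "b \<in> D \<Longrightarrow> b \<in> E \<Longrightarrow> \<tau> b c \<in> monomial_ideal E"
  by (auto simp: monomial_ideal_def term_closed coord_term)

lemma term_notin_monomial_ideal: "b \<in> D \<Longrightarrow> b \<notin> E \<Longrightarrow> \<tau> b 1 \<notin> monomial_ideal E"
  by (auto simp: monomial_ideal_def coord_term)

text \<open>
  Along a strict chain of ideals the sets of leading positions grow strictly, so there are at most
  \<open>card D\<close> steps. Conversely, enumerate the basis by increasing degree: multiplication by a term
  other than a scalar raises the degree, so each final segment of the enumeration is the index set of a
  monomial ideal, and these ideals form a chain with \<open>card D\<close> steps.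
\<close>

lemma chain_sup_ideals:
  assumes fin: "finite D"
  shows "chain_sup {N. ideal N A} = enat (card D)"
proof (rule antisym)
  obtain e where e: "bij_betw e {..<card D} D"
    and mono: "\<And>i j. i \<le> j \<Longrightarrow> j < card D \<Longrightarrow> \<delta> (e i) \<le> \<delta> (e j)"
    using finite_enumeration_sorted_by[OF fin, of \<delta>] by blast
  have eD: "e i \<in> D" if "i < card D" for i using e that by (auto simp: bij_betw_def)
  have e_inj: "e i = e j \<longleftrightarrow> i = j" if "i < card D" "j < card D" for i j
    using e that by (auto simp: bij_betw_def inj_on_def)
  show "chain_sup {N. ideal N A} \<le> enat (card D)"
    unfolding chain_sup_def
  proof (intro Sup_least, clarify)
    fix n and C :: "nat \<Rightarrow> 'a set"
    assume C: "\<forall>i\<le>n. C i \<in> {N. ideal N A}" "\<forall>i<n. C i \<subset> C (Suc i)"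
    have "n \<le> card {..<card D}"
    proof (rule strict_subset_chain_le_card[where L = "\<lambda>i. leading e (card D) (C i)"])
      show "leading e (card D) (C i) \<subset> leading e (card D) (C (Suc i))" if "i < n" for i
      proof -
        have "ideal (C i) A" "ideal (C (Suc i)) A" "C i \<subset> C (Suc i)" using C that by auto
        then show ?thesis
          using leading_mono[of "C i" "C (Suc i)" e "card D"] ideal_eq_if_leading_subset[OF _ _ _ e]
          by (metis psubsetE psubsetI)
      qed
    qed (auto simp: leading_def)
    then show "enat n \<le> enat (card D)" by simp
  qed
  define C where "C m = monomial_ideal (e ` {card D - m..<card D})" for m
  have "ideal (C m) A" for m
    unfolding C_def
  proof (rule ideal_monomial_ideal, unfold absorbing_def, intro ballI impI)
    fix b1 b2 assume b: "b1 \<in> D" "b2 \<in> D" "b1 + b2 \<in> D" "b2 \<in> e ` {card D - m..<card D}"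
    obtain i where i: "b2 = e i" "card D - m \<le> i" "i < card D" using b by auto
    obtain j where j: "b1 + b2 = e j" "j < card D" using b(3) e by (auto simp: bij_betw_def)
    have "card D - m \<le> j"
    proof (rule ccontr)
      assume "\<not> card D - m \<le> j"
      then have "\<delta> (e j) \<le> \<delta> (e i)" "j \<noteq> i" using mono[of j i] i by auto
      then have "\<delta> b1 = 0" using deg_add[of b1 b2] i j by simp
      then show False using deg_zero[OF b(1)] i j e_inj[of i j] \<open>j \<noteq> i\<close> by auto
    qed
    then show "b1 + b2 \<in> e ` {card D - m..<card D}" using j by auto
  qed
  moreover have "C m \<subset> C (Suc m)" if m: "m < card D" for m
  proof
    have "{card D - m..<card D} \<subseteq> {card D - Suc m..<card D}" by (simp only: ivl_subset) linarith
    then have "e ` {card D - m..<card D} \<subseteq> e ` {card D - Suc m..<card D}" by (rule image_mono)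
    then show "C m \<subseteq> C (Suc m)" unfolding C_def by (rule monomial_ideal_mono)
    define b where "b = e (card D - Suc m)"
    have b: "b \<in> D" using m by (simp add: b_def eD)
    have "card D - Suc m \<in> {card D - Suc m..<card D}" using m by simp
    then have "b \<in> e ` {card D - Suc m..<card D}" unfolding b_def by (rule imageI)
    then have "\<tau> b 1 \<in> C (Suc m)"
      unfolding C_def by (rule term_in_monomial_ideal[OF b])
    moreover have "i \<noteq> card D - Suc m" if "i \<in> {card D - m..<card D}" for i
      using that m by (simp only: atLeastLessThan_iff) linarith
    then have "b \<notin> e ` {card D - m..<card D}"
      using m e_inj[of "card D - Suc m"] unfolding b_def by fastforce
    then have "\<tau> b 1 \<notin> C m"
      unfolding C_def by (rule term_notin_monomial_ideal[OF b])
    ultimately show "C m \<noteq> C (Suc m)" by blast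
  qed
  ultimately show "enat (card D) \<le> chain_sup {N. ideal N A}"
    unfolding chain_sup_def by (intro Sup_upper) blast
qed

end

section \<open>Rees algebras\<close>

context cring
begin

lemma power_of_ideal:
  assumes "ideal J R"
  shows "ideal (J [^]\<^bsub>ideals_set R\<^esub> (n::nat)) R"
proof -
  interpret S: comm_monoid "ideals_set R" by (rule ideals_set_is_comm_monoid)
  show ?thesis using S.nat_pow_closed[of J n] assms by (simp add: ideals_set_def)
qed

lemma power_of_ideal_mult:
  assumes "ideal J R" "x \<in> J [^]\<^bsub>ideals_set R\<^esub> (m::nat)" "y \<in> J [^]\<^bsub>ideals_set R\<^esub> (n::nat)"
  shows "x \<otimes> y \<in> J [^]\<^bsub>ideals_set R\<^esub> (m + n)"
proof -
  interpret S: comm_monoid "ideals_set R" by (rule ideals_set_is_comm_monoid)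
  have "x \<otimes> y \<in> ideal_prod R (J [^]\<^bsub>ideals_set R\<^esub> m) (J [^]\<^bsub>ideals_set R\<^esub> n)"
    using assms by (intro ideal_prod.prod)
  also have "\<dots> = J [^]\<^bsub>ideals_set R\<^esub> (m + n)"
    using S.nat_pow_mult[of J m n] assms by (simp add: ideals_set_def)
  finally show ?thesis .
qed

lemma cring_rees_algebra:
  assumes J: "ideal J R"
  shows "cring (rees_algebra R J)"
proof -
  let ?K = "{p \<in> carrier (UP R). \<forall>j. up_ring.coeff (UP R) p j \<in> J [^]\<^bsub>ideals_set R\<^esub> j}"
  have pow: "ideal (J [^]\<^bsub>ideals_set R\<^esub> n) R" for n :: nat by (rule power_of_ideal[OF J])
  interpret P: UP_cring R "UP R" by unfold_locales
  interpret P: cring "UP R" by (rule P.UP_cring)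
  have "subring ?K (UP R)"
  proof (rule P.subringI)
    have "\<one> \<in> J [^]\<^bsub>ideals_set R\<^esub> (0::nat)" by (simp add: ideals_set_def)
    then show "\<one>\<^bsub>UP R\<^esub> \<in> ?K"
      using pow by (auto simp: additive_subgroup.zero_closed ideal_def)
  next
    fix p q
    assume p: "p \<in> ?K"
      and q: "q \<in> ?K"
    show "p \<otimes>\<^bsub>UP R\<^esub> q \<in> ?K"
    proof (intro CollectI conjI allI)
      fix n :: nat
      interpret N: ideal "J [^]\<^bsub>ideals_set R\<^esub> n" R by (rule pow)
      have c: "up_ring.coeff (UP R) p i \<otimes> up_ring.coeff (UP R) q (n - i) \<in> J [^]\<^bsub>ideals_set R\<^esub> n"
        if "i \<le> n" for i
        using power_of_ideal_mult[OF J, of "up_ring.coeff (UP R) p i" i "up_ring.coeff (UP R) q (n - i)" "n - i"]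
          p q that by simp
      have "(\<Oplus>i\<in>Z. up_ring.coeff (UP R) p i \<otimes> up_ring.coeff (UP R) q (n - i)) \<in> J [^]\<^bsub>ideals_set R\<^esub> n"
        if "finite Z" "Z \<subseteq> {..n}" for Z
        using that
      proof (induction Z rule: finite_induct)
        case (insert i Z)
        then show ?case
          using p q c[of i] by (subst finsum_insert) (auto intro!: N.a_closed)
      qed simp
      from this[of "{..n}"] show "up_ring.coeff (UP R) (p \<otimes>\<^bsub>UP R\<^esub> q) n \<in> J [^]\<^bsub>ideals_set R\<^esub> n"
        using p q by simp
    qed (use p q in simp)
    show "p \<oplus>\<^bsub>UP R\<^esub> q \<in> ?K"
      using p q pow by (auto simp: additive_subgroup.a_closed ideal_def)
  next
    fix p
    assume p: "p \<in> ?K"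
    then show "\<ominus>\<^bsub>UP R\<^esub> p \<in> ?K"
      using pow by (auto simp: additive_subgroup.a_inv_closed ideal_def)
  qed auto
  then show ?thesis
    unfolding rees_algebra_def
    by (intro P.subcring_iff[THEN iffD1] P.subcringI') (auto dest: subringE)
qed

end

context monomial_ring
begin

definition deg_filtration :: "nat \<Rightarrow> 'a set" where
  "deg_filtration j = {x \<in> carrier A. \<forall>b\<in>D. \<kappa> b x \<noteq> 0 \<longrightarrow> j \<le> \<delta> b}"

text \<open>
  When every nonunit basis element splits off a factor of degree \<open>1\<close>, the ring is standard graded, and
  the powers of its irrelevant ideal are the steps of the degree filtration.
\<close>

lemma deg_filtration_power:
  assumes split: "\<And>b. b \<in> D \<Longrightarrow> \<delta> b \<noteq> 0 \<Longrightarrow> \<exists>b1\<in>D. \<exists>b2\<in>D. b = b1 + b2 \<and> \<delta> b2 = 1"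
  shows "deg_filtration 1 [^]\<^bsub>ideals_set A\<^esub> j = deg_filtration j"
proof (induction j)
  case 0
  then show ?case by (simp add: ideals_set_def deg_filtration_def)
next
  case (Suc j)
  have "ideal_prod A (deg_filtration j) (deg_filtration 1) = deg_filtration (Suc j)"
  proof
    show "ideal_prod A (deg_filtration j) (deg_filtration 1) \<subseteq> deg_filtration (Suc j)"
    proof
      fix z assume "z \<in> ideal_prod A (deg_filtration j) (deg_filtration 1)"
      then show "z \<in> deg_filtration (Suc j)"
      proof (induction rule: ideal_prod.induct)
        case (prod x y)
        have "Suc j \<le> \<delta> b" if b: "b \<in> D" "\<kappa> b (x \<otimes> y) \<noteq> 0" for b
        proof -
          obtain b1 b2 where "b1 \<in> D" "b2 \<in> D" "b = b1 + b2" "\<kappa> b1 x \<noteq> 0" "\<kappa> b2 y \<noteq> 0"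
            using coord_mult[OF _ _ b] prod by (auto simp: deg_filtration_def)
          then have "j \<le> \<delta> b1" "1 \<le> \<delta> b2" "\<delta> b = \<delta> b1 + \<delta> b2"
            using prod by (auto simp: deg_filtration_def deg_add)
          then show ?thesis by simp
        qed
        then show ?case using prod by (auto simp: deg_filtration_def)
      next
        case (sum x y)
        then have "\<kappa> b x \<noteq> 0 \<or> \<kappa> b y \<noteq> 0" if "b \<in> D" "\<kappa> b (x \<oplus> y) \<noteq> 0" for b
          using that by (auto simp: deg_filtration_def coord_add)
        then show ?case using sum by (auto simp: deg_filtration_def)
      qed
    qed
    show "deg_filtration (Suc j) \<subseteq> ideal_prod A (deg_filtration j) (deg_filtration 1)"
    proof
      fix x assume x: "x \<in> deg_filtration (Suc j)"
      then have "x \<in> carrier A" by (simp add: deg_filtration_def)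
      then show "x \<in> ideal_prod A (deg_filtration j) (deg_filtration 1)"
      proof (induction rule: term_induct)
        case zero
        have "\<zero> \<otimes> \<zero> \<in> ideal_prod A (deg_filtration j) (deg_filtration 1)"
          by (intro ideal_prod.prod) (simp_all add: deg_filtration_def coord_zero)
        then show ?case by simp
      next
        case (add x y)
        then show ?case by (intro ideal_prod.sum)
      next
        case (monomial b c)
        then have d: "Suc j \<le> \<delta> b" using x by (auto simp: deg_filtration_def)
        then obtain b1 b2 where b: "b1 \<in> D" "b2 \<in> D" "b = b1 + b2" "\<delta> b2 = 1"
          using split[of b] monomial by auto
        then have "\<tau> b1 c \<in> deg_filtration j" "\<tau> b2 1 \<in> deg_filtration 1"
          using d by (auto simp: deg_filtration_def deg_add term_closed coord_term)
        then have "\<tau> b1 c \<otimes> \<tau> b2 1 \<in> ideal_prod A (deg_filtration j) (deg_filtration 1)"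
          by (rule ideal_prod.prod)
        then show ?case using b monomial by (simp add: term_mult)
      qed
    qed
  qed
  then show ?case using Suc by (simp add: ideals_set_def)
qed

lemma ideal_deg_filtration: "ideal (deg_filtration j) A"
proof -
  have "deg_filtration j = monomial_ideal {b. j \<le> \<delta> b}"
    by (auto simp: deg_filtration_def monomial_ideal_def)
  then show ?thesis using ideal_monomial_ideal[of "{b. j \<le> \<delta> b}"]
    by (simp add: absorbing_def deg_add)
qed

text \<open>
  The Rees algebra of the irrelevant ideal has the basis \<open>x\<^sup>b t\<^sup>j\<close> with \<open>j \<le> \<delta> b\<close>. The degree of
  \<open>x\<^sup>b t\<^sup>j\<close> is taken to be \<open>\<delta> b\<close>: since \<open>j \<le> \<delta> b\<close>, it still vanishes only at the unit.
\<close>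

lemma monomial_ring_rees:
  assumes split: "\<And>b. b \<in> D \<Longrightarrow> \<delta> b \<noteq> 0 \<Longrightarrow> \<exists>b1\<in>D. \<exists>b2\<in>D. b = b1 + b2 \<and> \<delta> b2 = 1"
    and n: "n = deg_filtration 1"
  shows "monomial_ring (rees_algebra A n) {(b, j). b \<in> D \<and> j \<le> \<delta> b}
           (\<lambda>(b, j) p. \<kappa> b (up_ring.coeff (UP A) p j)) (\<lambda>(b, j) c. up_ring.monom (UP A) (\<tau> b c) j)
           (\<lambda>(b, j). \<delta> b)"
proof -
  let ?D = "{(b, j). b \<in> D \<and> j \<le> \<delta> b}"
  let ?R = "rees_algebra A n"
  interpret P: UP_cring A "UP A" by unfold_locales
  interpret R: cring ?R unfolding n by (intro cring_rees_algebra ideal_deg_filtration)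
  have carr: "p \<in> carrier ?R \<longleftrightarrow> p \<in> carrier (UP A) \<and>
      (\<forall>b\<in>D. \<forall>j. \<kappa> b (up_ring.coeff (UP A) p j) \<noteq> 0 \<longrightarrow> j \<le> \<delta> b)" for p
  proof -
    have "p \<in> carrier ?R \<longleftrightarrow> p \<in> carrier (UP A) \<and> (\<forall>j. up_ring.coeff (UP A) p j \<in> deg_filtration j)"
      by (simp add: rees_algebra_def n deg_filtration_power[OF split, simplified])
    then show ?thesis by (auto simp: deg_filtration_def)
  qed
  have ops: "monoid.mult ?R = monoid.mult (UP A)" "add ?R = add (UP A)"
    by (simp_all add: rees_algebra_def)
  show ?thesis
  proof (intro monomial_ring.intro R.is_cring monomial_ring_axioms.intro)
    show "0 \<in> ?D" by (simp add: zero_prod_def zero_index)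
  next
    fix b c assume "b \<in> ?D"
    then show "(case b of (b, j) \<Rightarrow> \<lambda>c. up_ring.monom (UP A) (\<tau> b c) j) c \<in> carrier ?R"
      by (auto simp: carr term_closed coord_term coord_zero split: if_splits)
  next
    fix b b' c assume "b \<in> ?D" "b' \<in> ?D"
    then show "(case b' of (b, j) \<Rightarrow> \<lambda>p. \<kappa> b (up_ring.coeff (UP A) p j))
        ((case b of (b, j) \<Rightarrow> \<lambda>c. up_ring.monom (UP A) (\<tau> b c) j) c) = (if b' = b then c else 0)"
      by (auto simp: term_closed coord_term coord_zero split: if_splits)
  next
    fix p q b assume "p \<in> carrier ?R" "q \<in> carrier ?R" "b \<in> ?D"
    then show "(case b of (b, j) \<Rightarrow> \<lambda>p. \<kappa> b (up_ring.coeff (UP A) p j)) (p \<oplus>\<^bsub>?R\<^esub> q) =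
        (case b of (b, j) \<Rightarrow> \<lambda>p. \<kappa> b (up_ring.coeff (UP A) p j)) p +
        (case b of (b, j) \<Rightarrow> \<lambda>p. \<kappa> b (up_ring.coeff (UP A) p j)) q"
      by (auto simp: carr ops coord_add)
  next
    fix p q assume p: "p \<in> carrier ?R" and q: "q \<in> carrier ?R"
      and eq: "\<And>b. b \<in> ?D \<Longrightarrow>
        (case b of (b, j) \<Rightarrow> \<lambda>p. \<kappa> b (up_ring.coeff (UP A) p j)) p =
        (case b of (b, j) \<Rightarrow> \<lambda>p. \<kappa> b (up_ring.coeff (UP A) p j)) q"
    have "\<kappa> b (up_ring.coeff (UP A) p j) = \<kappa> b (up_ring.coeff (UP A) q j)" if "b \<in> D" for b j
    proof (cases "j \<le> \<delta> b")
      case True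
      then show ?thesis using eq[of "(b, j)"] that by simp
    next
      case False
      then have "\<kappa> b (up_ring.coeff (UP A) p j) = 0" "\<kappa> b (up_ring.coeff (UP A) q j) = 0"
        using p q that unfolding carr by blast+
      then show ?thesis by simp
    qed
    then show "p = q"
      using p q by (intro P.up_eqI coord_eqI) (auto simp: carr)
  next
    fix p assume p: "p \<in> carrier ?R"
    then have "p \<in> carrier (UP A)" by (simp add: carr)
    then obtain n where "\<And>j. n < j \<Longrightarrow> up_ring.coeff (UP A) p j = \<zero>"
      using bound_upD[of p] by (auto simp: UP_def bound_def)
    then have "{b \<in> ?D.
        (case b of (b, j) \<Rightarrow> \<lambda>p. \<kappa> b (up_ring.coeff (UP A) p j)) p \<noteq> 0}
      \<subseteq> (\<Union>j\<in>{..n}. (\<lambda>b. (b, j)) ` {b \<in> D. \<kappa> b (up_ring.coeff (UP A) p j) \<noteq> 0})"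
      using coord_zero by (force simp: not_less[symmetric])
    moreover have "finite \<dots>"
      using \<open>p \<in> carrier (UP A)\<close> by (intro finite_UN_I finite_imageI finite_support) auto
    ultimately show "finite {b \<in> ?D.
        (case b of (b, j) \<Rightarrow> \<lambda>p. \<kappa> b (up_ring.coeff (UP A) p j)) p \<noteq> 0}"
      by (rule finite_subset)
  next
    fix p q b assume p: "p \<in> carrier ?R" and q: "q \<in> carrier ?R"
      and b: "b \<in> ?D"
      and nz: "(case b of (b, j) \<Rightarrow> \<lambda>p. \<kappa> b (up_ring.coeff (UP A) p j)) (p \<otimes>\<^bsub>?R\<^esub> q) \<noteq> 0"
    obtain a n where a: "b = (a, n)" "a \<in> D" "n \<le> \<delta> a" using b by auto
    have pq: "p \<in> carrier (UP A)" "q \<in> carrier (UP A)" using p q by (auto simp: carr)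
    have "(\<Sum>i\<in>{..n}. \<kappa> a (up_ring.coeff (UP A) p i \<otimes> up_ring.coeff (UP A) q (n - i))) \<noteq> 0"
      using nz a pq by (simp add: ops coord_finsum Pi_def)
    then obtain i where i: "i \<le> n" "\<kappa> a (up_ring.coeff (UP A) p i \<otimes> up_ring.coeff (UP A) q (n - i)) \<noteq> 0"
      by (meson atMost_iff sum.neutral)
    then obtain a1 a2 where a12: "a1 \<in> D" "a2 \<in> D" "a = a1 + a2"
        "\<kappa> a1 (up_ring.coeff (UP A) p i) \<noteq> 0" "\<kappa> a2 (up_ring.coeff (UP A) q (n - i)) \<noteq> 0"
      using coord_mult a pq by (metis P.coeff_closed)
    then have "i \<le> \<delta> a1" "n - i \<le> \<delta> a2" using p q by (auto simp: carr)
    then show "\<exists>b1\<in>?D. \<exists>b2\<in>?D. b = b1 + b2 \<and>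
        (case b1 of (b, j) \<Rightarrow> \<lambda>p. \<kappa> b (up_ring.coeff (UP A) p j)) p \<noteq> 0 \<and>
        (case b2 of (b, j) \<Rightarrow> \<lambda>p. \<kappa> b (up_ring.coeff (UP A) p j)) q \<noteq> 0"
      using a a12 i by (intro bexI[of _ "(a1, i)"] bexI[of _ "(a2, n - i)"]) auto
  next
    fix b1 b2 c1 c2
    assume "b1 \<in> ?D" "b2 \<in> ?D"
      "b1 + b2 \<in> ?D"
    then show "(case b1 of (b, j) \<Rightarrow> \<lambda>c. up_ring.monom (UP A) (\<tau> b c) j) c1 \<otimes>\<^bsub>?R\<^esub>
        (case b2 of (b, j) \<Rightarrow> \<lambda>c. up_ring.monom (UP A) (\<tau> b c) j) c2 =
        (case b1 + b2 of (b, j) \<Rightarrow> \<lambda>c. up_ring.monom (UP A) (\<tau> b c) j) (c1 * c2)"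
      by (auto simp: ops term_mult[symmetric] term_closed simp flip: P.monom_mult)
  next
    show "(case b1 + b2 of (b, j) \<Rightarrow> \<delta> b) = (case b1 of (b, j) \<Rightarrow> \<delta> b) + (case b2 of (b, j) \<Rightarrow> \<delta> b)"
      for b1 b2 :: "'i \<times> nat" by (cases b1; cases b2) (simp add: deg_add)
  next
    show "b = 0" if "b \<in> ?D" "(case b of (b, j) \<Rightarrow> \<delta> b) = 0" for b
      using that deg_zero by (auto simp: zero_prod_def)
  qed
qed

end

section \<open>Counting exponent vectors\<close>

abbreviation expt :: "('n \<Rightarrow>\<^sub>0 nat) \<Rightarrow> 'n \<Rightarrow> nat" where
  "expt \<equiv> Poly_Mapping.lookup"

abbreviation supp :: "('n \<Rightarrow>\<^sub>0 nat) \<Rightarrow> 'n set" where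
  "supp \<equiv> Poly_Mapping.keys"

definition tdeg :: "('n::finite \<Rightarrow>\<^sub>0 nat) \<Rightarrow> nat" where
  "tdeg a = (\<Sum>i\<in>UNIV. expt a i)"

lemma tdeg_zero [simp]: "tdeg 0 = 0"
  by (simp add: tdeg_def)

lemma tdeg_add: "tdeg (a + b) = tdeg a + tdeg b"
  by (simp add: tdeg_def lookup_add sum.distrib)

lemma tdeg_single [simp]: "tdeg (Poly_Mapping.single i v) = v"
  by (simp add: tdeg_def lookup_single when_def)

lemma tdeg_eq_0_iff: "tdeg a = 0 \<longleftrightarrow> a = 0"
proof
  assume "tdeg a = 0"
  then have "expt a i = 0" for i by (simp add: tdeg_def)
  then show "a = 0" by (intro poly_mapping_eqI) simp
qed simp

lemma expt_le_tdeg: "expt a i \<le> tdeg a"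
  unfolding tdeg_def by (rule member_le_sum) auto

lemma expt_add_le_tdeg: "i \<noteq> j \<Longrightarrow> expt a i + expt a j \<le> tdeg a"
  using sum_mono2[of UNIV "{i, j}" "expt a"] by (simp add: tdeg_def)

lemma supp_add: "supp (a + b) = supp a \<union> supp b"
  by (auto simp: in_keys_iff lookup_add)

lemma diff_add_single:
  fixes a :: "'n \<Rightarrow>\<^sub>0 nat"
  assumes "v \<le> expt a i"
  shows "a - Poly_Mapping.single i v + Poly_Mapping.single i v = a"
  using assms by (intro poly_mapping_eqI) (auto simp: lookup_add lookup_minus lookup_single when_def)

text \<open>
  Splitting off the exponent of one variable \<open>i\<close> reduces a count over the support \<open>insert i F\<close> to
  counts over \<open>F\<close>. The exponent of \<open>i\<close> is positive, hence the shift by \<open>Suc\<close>. The sets \<open>U v\<close> and \<open>W\<close>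
  stay abstract because the reduction is used for two different conditions on the exponents.
\<close>

lemma bij_betw_supp_insert:
  assumes "i \<notin> F"
    and V: "\<And>a v. supp a = F \<Longrightarrow> (v \<in> V \<and> a \<in> U v) \<longleftrightarrow> a + Poly_Mapping.single i (Suc v) \<in> W"
    and U: "\<And>v. U v \<subseteq> {a. supp a = F}" and W: "W \<subseteq> {a. supp a = insert i F}"
  shows "bij_betw (\<lambda>(v, a). a + Poly_Mapping.single i (Suc v)) (Sigma V U) W"
proof (rule bij_betwI[where g = "\<lambda>a. (expt a i - 1, a - Poly_Mapping.single i (expt a i))"])
  show "(\<lambda>(v, a). a + Poly_Mapping.single i (Suc v)) \<in> Sigma V U \<rightarrow> W"
    using V U by fastforce
next
  have *: "a - Poly_Mapping.single i (expt a i) + Poly_Mapping.single i (Suc (expt a i - 1)) = a"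
    "supp (a - Poly_Mapping.single i (expt a i)) = F" if "a \<in> W" for a
  proof -
    have a: "supp a = insert i F" using that W by blast
    then have "expt a i \<noteq> 0" using in_keys_iff[of i a] by simp
    then show "a - Poly_Mapping.single i (expt a i) + Poly_Mapping.single i (Suc (expt a i - 1)) = a"
      by (simp add: diff_add_single)
    have "k \<in> supp (a - Poly_Mapping.single i (expt a i)) \<longleftrightarrow> k \<in> F" for k
      using a assms(1) by (cases "k = i") (auto simp: in_keys_iff lookup_minus lookup_single when_def set_eq_iff)
    then show "supp (a - Poly_Mapping.single i (expt a i)) = F" by blast
  qed
  then show "(\<lambda>a. (expt a i - 1, a - Poly_Mapping.single i (expt a i))) \<in> W \<rightarrow> Sigma V U"
    using V[OF *(2)] by (fastforce simp: *)
  show "(case (expt a i - 1, a - Poly_Mapping.single i (expt a i)) of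
      (v, a) \<Rightarrow> a + Poly_Mapping.single i (Suc v)) = a" if "a \<in> W" for a
    using * that by simp
next
  fix x assume x: "x \<in> Sigma V U"
  obtain v a where va: "x = (v, a)" by (cases x)
  have "expt a i = 0" using x va U[of v] assms(1) by (auto simp: in_keys_iff)
  then show "(expt (case x of (v, a) \<Rightarrow> a + Poly_Mapping.single i (Suc v)) i - 1,
      (case x of (v, a) \<Rightarrow> a + Poly_Mapping.single i (Suc v)) -
      Poly_Mapping.single i (expt (case x of (v, a) \<Rightarrow> a + Poly_Mapping.single i (Suc v)) i)) = x"
    using va by (simp add: lookup_add)
qed

text \<open>
  Lattice points of a simplex: peeling off one exponent gives \<open>\<Sum>m<j. m choose card F\<close>, the hockey
  stick sum.
\<close>

lemma card_supp_tdeg_le: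
  fixes F :: "'n::finite set"
  shows "finite {a. supp a = F \<and> tdeg a \<le> j} \<and> card {a. supp a = F \<and> tdeg a \<le> j} = j choose card F"
proof (induction F arbitrary: j rule: finite_induct[OF finite])
  case 1
  have "{a::'n \<Rightarrow>\<^sub>0 nat. supp a = {} \<and> tdeg a \<le> j} = {0}" by auto
  then show ?case by simp
next
  case (2 i F)
  let ?U = "\<lambda>v. {a::'n \<Rightarrow>\<^sub>0 nat. supp a = F \<and> tdeg a \<le> j - Suc v}"
  let ?W = "{a. supp a = insert i F \<and> tdeg a \<le> j}"
  have bij: "bij_betw (\<lambda>(v, a). a + Poly_Mapping.single i (Suc v)) (Sigma {..<j} ?U) ?W"
    using 2 by (intro bij_betw_supp_insert[where F = F]) (auto simp: supp_add tdeg_add)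
  have "finite (Sigma {..<j} ?U)" using 2 by auto
  moreover have "card (Sigma {..<j} ?U) = (\<Sum>v<j. (j - Suc v) choose card F)"
    using 2 by (subst card_SigmaI) auto
  moreover have "\<dots> = (\<Sum>m<j. m choose card F)"
    by (rule sum.nat_diff_reindex)
  moreover have "\<dots> = j choose Suc (card F)"
    by (induction j) auto
  ultimately show ?case
    using bij_betw_finite[OF bij] bij_betw_same_card[OF bij] 2 by simp
qed

text \<open>
  By the symmetry \<open>a\<^sub>i \<leftrightarrow> r + 1 - a\<^sub>i\<close> each exponent has average \<open>(r + 1) / 2\<close> over the box, which
  explains the degree sum.
\<close>

lemma card_box:
  fixes F :: "'n::finite set"
  shows "finite {a. supp a = F \<and> (\<forall>i\<in>F. expt a i \<le> r)} \<and>
    card {a. supp a = F \<and> (\<forall>i\<in>F. expt a i \<le> r)} = r ^ card F \<and>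
    2 * (\<Sum>a | supp a = F \<and> (\<forall>i\<in>F. expt a i \<le> r). tdeg a) = card F * r ^ card F * Suc r"
proof (induction F rule: finite_induct[OF finite])
  case 1
  have "{a::'n \<Rightarrow>\<^sub>0 nat. supp a = {} \<and> (\<forall>i\<in>{}. expt a i \<le> r)} = {0}" by auto
  then show ?case by simp
next
  case (2 i F)
  let ?B = "{a::'n \<Rightarrow>\<^sub>0 nat. supp a = F \<and> (\<forall>i\<in>F. expt a i \<le> r)}"
  let ?W = "{a. supp a = insert i F \<and> (\<forall>k\<in>insert i F. expt a k \<le> r)}"
  have bij: "bij_betw (\<lambda>(v, a). a + Poly_Mapping.single i (Suc v)) (Sigma {..<r} (\<lambda>_. ?B)) ?W"
  proof (intro bij_betw_supp_insert[where F = F])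
    fix a :: "'n \<Rightarrow>\<^sub>0 nat" and v assume a: "supp a = F"
    have "expt (a + Poly_Mapping.single i (Suc v)) k = (if k = i then Suc v else expt a k)" for k
      using 2 a by (auto simp: lookup_add lookup_single when_def simp flip: not_in_keys_iff_lookup_eq_zero)
    moreover have "supp (a + Poly_Mapping.single i (Suc v)) = insert i F"
      using a by (simp add: supp_add)
    ultimately show "(v \<in> {..<r} \<and> a \<in> ?B) \<longleftrightarrow> a + Poly_Mapping.single i (Suc v) \<in> ?W"
      using a 2 by (auto split: if_splits)
  qed (use 2 in auto)
  have "(\<Sum>a\<in>?W. tdeg a) = (\<Sum>(v, a)\<in>{..<r} \<times> ?B. tdeg a + Suc v)"
    using sum.reindex_bij_betw[OF bij, of tdeg] by (simp add: case_prod_beta tdeg_add)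
  also have "\<dots> = r * (\<Sum>a\<in>?B. tdeg a) + card ?B * (\<Sum>v<r. Suc v)"
  proof -
    have "(\<Sum>(v, a)\<in>{..<r} \<times> ?B. tdeg a + Suc v) = (\<Sum>v<r. \<Sum>a\<in>?B. tdeg a + Suc v)"
      by (rule sum.cartesian_product[symmetric])
    also have "\<dots> = (\<Sum>v<r. (\<Sum>a\<in>?B. tdeg a) + card ?B * Suc v)"
      by (intro sum.cong refl) (simp only: sum.distrib sum_constant of_nat_id)
    also have "\<dots> = r * (\<Sum>a\<in>?B. tdeg a) + card ?B * (\<Sum>v<r. Suc v)"
      by (simp only: sum.distrib sum_constant sum_distrib_left card_lessThan of_nat_id)
    finally show ?thesis .
  qed
  also have "2 * \<dots> = r * (card F * r ^ card F * Suc r) + r ^ card F * (r * Suc r)"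
  proof -
    have "2 * (\<Sum>v<r. Suc v) = r * Suc r" by (induction r) auto
    moreover have "card ?B = r ^ card F" "2 * (\<Sum>a\<in>?B. tdeg a) = card F * r ^ card F * Suc r"
      using 2 by blast+
    ultimately show ?thesis by (simp only: distrib_left mult.left_commute[of 2])
  qed
  finally have "2 * (\<Sum>a\<in>?W. tdeg a) = card (insert i F) * r ^ card (insert i F) * Suc r"
    using 2 by (simp add: algebra_simps)
  moreover have "finite ?W" "card ?W = r ^ card (insert i F)"
    using bij_betw_finite[OF bij] bij_betw_same_card[OF bij] 2 by auto
  ultimately show ?case by blast
qed

text \<open>
  The indices of the terms in the Frobenius power: \<open>x\<^sup>a t\<^sup>j\<close> with \<open>j \<le> \<bar>a\<bar>\<close> is a multiple of
  \<open>x\<^sub>i\<^sup>s t\<^sup>s\<close> if \<open>s \<le> a\<^sub>i\<close> and \<open>s \<le> j\<close>, and of \<open>x\<^sub>i\<^sup>s\<close> if \<open>s \<le> a\<^sub>i\<close> and the cofactor of degree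
  \<open>\<bar>a\<bar> - s\<close> can carry \<open>t\<^sup>j\<close>.
\<close>

definition frobenius_index :: "nat \<Rightarrow> ('n::finite \<Rightarrow>\<^sub>0 nat) \<times> nat \<Rightarrow> bool" where
  "frobenius_index s = (\<lambda>(a, j). \<exists>i. s \<le> expt a i \<and> (s \<le> j \<or> j + s \<le> tdeg a))"

text \<open>
  The complement of the Frobenius power over a fixed support \<open>F\<close> consists of the box where all
  exponents are smaller than \<open>s\<close>, with any \<open>j \<le> \<bar>a\<bar>\<close>, and, for each \<open>i \<in> F\<close>, of the pairs with
  \<open>a\<^sub>i \<ge> s\<close> and \<open>\<bar>a\<bar> - s < j < s\<close>. In the latter case \<open>\<bar>a\<bar> < 2 * s\<close>, so \<open>i\<close> is unique; lowering \<open>a\<^sub>i\<close> by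
  \<open>s - 1\<close> keeps the support and turns the condition into \<open>\<bar>a\<bar> \<le> j < s\<close>, which is a stack of simplices.
  The factor \<open>2\<close> avoids division.
\<close>

lemma card_frobenius_complement:
  fixes F :: "'n::finite set"
  assumes "s = Suc r"
  shows "finite {(a, j). supp a = F \<and> j \<le> tdeg a \<and> \<not> frobenius_index s (a, j)} \<and>
    2 * card {(a, j). supp a = F \<and> j \<le> tdeg a \<and> \<not> frobenius_index s (a, j)} =
      card F * r ^ card F * s + 2 * r ^ card F + 2 * (card F * (s choose Suc (card F)))"
proof -
  let ?B = "{a. supp a = F \<and> (\<forall>i\<in>F. expt a i \<le> r)}"
  let ?Box = "Sigma ?B (\<lambda>a. {..tdeg a})"
  let ?T = "\<lambda>i. {(a, j). supp a = F \<and> s \<le> expt a i \<and> j < s \<and> tdeg a < j + s}"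
  have T0: "finite ?Box" "2 * card ?Box = card F * r ^ card F * s + 2 * r ^ card F"
    using card_box[of F r] assms by (auto simp: card_SigmaI sum.distrib sum_Suc)
  have T: "finite (?T i) \<and> card (?T i) = s choose Suc (card F)" if i: "i \<in> F" for i
  proof -
    let ?S = "\<lambda>j. {a. supp a = F \<and> tdeg a \<le> j}"
    have "bij_betw (\<lambda>(j, a). (a + Poly_Mapping.single i r, j)) (Sigma {..<s} ?S) (?T i)"
    proof (rule bij_betwI[where g = "\<lambda>(a, j). (j, a - Poly_Mapping.single i r)"])
      show "(\<lambda>(j, a). (a + Poly_Mapping.single i r, j)) \<in> Sigma {..<s} ?S \<rightarrow> ?T i"
        using i assms by (auto simp: supp_add tdeg_add lookup_add in_keys_iff split: if_splits)
      show "(\<lambda>(a, j). (j, a - Poly_Mapping.single i r)) \<in> ?T i \<rightarrow> Sigma {..<s} ?S"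
      proof safe
        fix a j k assume a: "F = supp a" "s \<le> expt a i" "tdeg a < j + s"
        have "tdeg (a - Poly_Mapping.single i r) + r = tdeg a"
          using tdeg_add[of "a - Poly_Mapping.single i r" "Poly_Mapping.single i r"] a assms
          by (simp add: diff_add_single)
        then show "tdeg (a - Poly_Mapping.single i r) \<le> j" using a assms by simp
        show "k \<in> supp a" if "k \<in> supp (a - Poly_Mapping.single i r)"
          using that by (auto simp: in_keys_iff lookup_minus)
        show "k \<in> supp (a - Poly_Mapping.single i r)" if "k \<in> supp a"
          using that a assms by (cases "k = i") (auto simp: in_keys_iff lookup_minus lookup_single when_def)
      qed
    qed (use assms in \<open>auto simp: diff_add_single\<close>)
    note bij = this
    have "finite (Sigma {..<s} ?S)" using card_supp_tdeg_le by auto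
    moreover have "card (Sigma {..<s} ?S) = (\<Sum>j<s. j choose card F)"
      using card_supp_tdeg_le by (subst card_SigmaI) auto
    moreover have "\<dots> = s choose Suc (card F)" by (induction s) auto
    ultimately show ?thesis
      using bij_betw_finite[OF bij] bij_betw_same_card[OF bij] by simp
  qed
  have disj: "?T i \<inter> ?T k = {}" if "i \<noteq> k" for i k
  proof -
    have False if "s \<le> expt a i" "s \<le> expt a k" "j < s" "tdeg a < j + s" for a j
      using that expt_add_le_tdeg[OF \<open>i \<noteq> k\<close>, of a] by linarith
    then show ?thesis by blast
  qed
  have "card (\<Union>i\<in>F. ?T i) = card F * (s choose Suc (card F))"
    using T disj by (subst card_UN_disjoint) auto
  moreover have "?Box \<inter> (\<Union>i\<in>F. ?T i) = {}" using assms by fastforce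
  moreover have "{(a, j). supp a = F \<and> j \<le> tdeg a \<and> \<not> frobenius_index s (a, j)} = ?Box \<union> (\<Union>i\<in>F. ?T i)"
  proof (intro equalityI subsetI)
    fix x assume x: "x \<in> {(a, j). supp a = F \<and> j \<le> tdeg a \<and> \<not> frobenius_index s (a, j)}"
    obtain a j where aj: "x = (a, j)" by (cases x)
    show "x \<in> ?Box \<union> (\<Union>i\<in>F. ?T i)"
    proof (cases "\<forall>i\<in>F. expt a i \<le> r")
      case False
      then obtain i where "i \<in> F" "s \<le> expt a i" using assms by (auto simp: not_le)
      then show ?thesis using x aj by (auto simp: frobenius_index_def)
    qed (use x aj in auto)
  next
    fix x assume "x \<in> ?Box \<union> (\<Union>i\<in>F. ?T i)"
    then show "x \<in> {(a, j). supp a = F \<and> j \<le> tdeg a \<and> \<not> frobenius_index s (a, j)}"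
    proof
      assume x: "x \<in> ?Box"
      then obtain a j where aj: "x = (a, j)" "supp a = F" "\<forall>i\<in>F. expt a i \<le> r" "j \<le> tdeg a" by auto
      have "expt a i < s" for i
        using aj assms by (cases "i \<in> F") (auto simp: in_keys_iff less_Suc_eq_le)
      then show ?thesis using aj by (auto simp: frobenius_index_def not_le)
    next
      assume "x \<in> (\<Union>i\<in>F. ?T i)"
      then show ?thesis
        using expt_le_tdeg by (fastforce simp: frobenius_index_def dest: order_trans)
    qed
  qed
  ultimately show ?thesis
    using T0 T by (simp add: card_Un_disjoint)
qed

lemma binomial_poly:
  "poly (smult (1 / fact k) (\<Prod>i<k. [:- of_nat i, 1:])) (of_nat n) = (of_nat (n choose k) :: rat)"
  by (simp add: binomial_gbinomial gbinomial_prod_rev poly_prod atLeast0LessThan)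

lemma card_frobenius_complement_polynomial:
  fixes \<Delta> :: "'n::finite set set"
  shows "\<exists>Q :: rat poly. \<forall>s::nat. s \<ge> 1 \<longrightarrow>
    finite {(a, j). supp a \<in> \<Delta> \<and> j \<le> tdeg a \<and> \<not> frobenius_index s (a, j)} \<and>
    of_nat (card {(a, j). supp a \<in> \<Delta> \<and> j \<le> tdeg a \<and> \<not> frobenius_index s (a, j)}) = poly Q (of_nat s)"
proof -
  define q where "q f = smult (of_nat f / 2) ([:-1, 1:] ^ f * [:0, 1:]) + [:-1, 1:] ^ f +
      smult (of_nat f / fact (Suc f)) (\<Prod>i<Suc f. [:- of_nat i, 1:] :: rat poly)" for f :: nat
  have "finite {(a, j). supp a \<in> \<Delta> \<and> j \<le> tdeg a \<and> \<not> frobenius_index s (a, j)} \<and>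
    of_nat (card {(a, j). supp a \<in> \<Delta> \<and> j \<le> tdeg a \<and> \<not> frobenius_index s (a, j)}) =
      poly (\<Sum>F\<in>\<Delta>. q (card F)) (of_nat s :: rat)" if s: "s \<ge> 1" for s :: nat
  proof -
    obtain r where r: "s = Suc r" using s by (cases s) auto
    let ?T = "\<lambda>F. {(a, j). supp a = F \<and> j \<le> tdeg a \<and> \<not> frobenius_index s (a, j)}"
    have "of_nat (card (?T F)) = poly (q (card F)) (of_nat s :: rat)" for F :: "'n set"
    proof -
      let ?f = "card F"
      have "(2::rat) * of_nat (card (?T F)) =
          of_nat (?f * r ^ ?f * s + 2 * r ^ ?f + 2 * (?f * (s choose Suc ?f)))"
        unfolding card_frobenius_complement[OF r, THEN conjunct2, symmetric] by simp
      moreover have "poly (q ?f) (of_nat s) = of_nat ?f / 2 * of_nat r ^ ?f * of_nat s + of_nat r ^ ?f +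
          of_nat ?f * (of_nat (s choose Suc ?f) :: rat)"
        unfolding binomial_poly[symmetric] by (simp add: q_def r)
      ultimately show ?thesis by (simp add: field_simps)
    qed
    moreover have "{(a, j). supp a \<in> \<Delta> \<and> j \<le> tdeg a \<and> \<not> frobenius_index s (a, j)} = (\<Union>F\<in>\<Delta>. ?T F)"
      by auto
    moreover have "finite (?T F)" for F :: "'n set" using card_frobenius_complement[OF r, of F] by blast
    moreover have "card (\<Union>F\<in>\<Delta>. ?T F) = (\<Sum>F\<in>\<Delta>. card (?T F))"
      using \<open>\<And>F. finite (?T F)\<close> by (intro card_UN_disjoint) auto
    ultimately show ?thesis by (simp add: poly_sum)
  qed
  then show ?thesis by blast
qed

section \<open>Stanley-Reisner rings and their Rees algebras\<close>

lemma carrier_mpol_ring: "carrier mpol_ring = UNIV"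
  by (simp add: mpol_ring_def carrier_class set_eq_iff)

lemma monomial_ring_mpol_ring:
  "monomial_ring (mpol_ring :: ('n::finite, 'k::field) mpol ring) UNIV
     (\<lambda>a f. Poly_Mapping.lookup f a) Poly_Mapping.single tdeg"
proof (intro monomial_ring.intro monomial_ring_axioms.intro)
  show "cring (mpol_ring :: ('n, 'k) mpol ring)"
    unfolding mpol_ring_def by (rule cring_class)
next
  fix f g :: "('n, 'k) mpol" and a
  assume "Poly_Mapping.lookup (f \<otimes>\<^bsub>mpol_ring\<^esub> g) a \<noteq> 0"
  then have "a \<in> Poly_Mapping.keys (f * g)"
    by (simp add: mpol_ring_def times_class in_keys_iff)
  then show "\<exists>b1\<in>UNIV. \<exists>b2\<in>UNIV. a = b1 + b2 \<and>
      Poly_Mapping.lookup f b1 \<noteq> 0 \<and> Poly_Mapping.lookup g b2 \<noteq> 0"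
    using keys_mult[of f g] by (auto simp: in_keys_iff)
qed (auto simp: mpol_ring_def class_simps lookup_add lookup_single when_def mult_single tdeg_add
       tdeg_eq_0_iff intro: poly_mapping_eqI)

lemma Idl_variables:
  "Idl\<^bsub>mpol_ring\<^esub> (mpol_var ` V) =
    {f :: ('n::finite, 'k::field) mpol. \<forall>a. supp a \<inter> V = {} \<longrightarrow> Poly_Mapping.lookup f a = 0}"
proof -
  interpret S: monomial_ring "mpol_ring :: ('n, 'k) mpol ring" UNIV
    "\<lambda>a f. Poly_Mapping.lookup f a" Poly_Mapping.single tdeg
    by (rule monomial_ring_mpol_ring)
  have "Idl\<^bsub>mpol_ring\<^esub> (mpol_var ` V :: ('n, 'k) mpol set) = S.monomial_ideal {a. supp a \<inter> V \<noteq> {}}"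
  proof (rule S.genideal_eq_monomial_ideal)
    show "S.absorbing {a. supp a \<inter> V \<noteq> {}}"
      by (auto simp: S.absorbing_def supp_add)
    show "(mpol_var ` V :: ('n, 'k) mpol set) \<subseteq> S.monomial_ideal {a. supp a \<inter> V \<noteq> {}}"
      by (auto simp: mpol_var_def intro!: S.term_in_monomial_ideal)
    fix a assume "a \<in> {a. supp a \<inter> V \<noteq> {}}"
    then obtain i where i: "i \<in> V" "i \<in> supp a" by blast
    then have "a = Poly_Mapping.single i 1 + (a - Poly_Mapping.single i 1)"
      using diff_add_single[of 1 a i] by (simp add: in_keys_iff add.commute)
    then show "\<exists>g\<in>UNIV. \<exists>d\<in>UNIV. a = g + d \<and> Poly_Mapping.single g 1 \<in> (mpol_var ` V :: ('n, 'k) mpol set)"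
      using i by (auto simp: mpol_var_def)
  qed
  also have "\<dots> = {f. \<forall>a. supp a \<inter> V = {} \<longrightarrow> Poly_Mapping.lookup f a = 0}"
    by (auto simp: S.monomial_ideal_def carrier_mpol_ring)
  finally show ?thesis .
qed

lemma mpol_var_pow:
  "(mpol_var i :: ('n::finite, 'k::field) mpol) [^]\<^bsub>mpol_ring\<^esub> s = Poly_Mapping.single (Poly_Mapping.single i s) 1"
  unfolding mpol_ring_def power_class
  by (induction s) (simp_all add: mpol_var_def mult_single flip: single_add)

text \<open>
  Here \<open>I\<close> is the Stanley-Reisner ideal of the simplicial complex \<open>\<Delta>\<close>: a monomial survives in the
  quotient iff its support is a face. The ring \<open>R\<close>, its Rees algebra and the quotient by the
  Frobenius power are, in turn, rings with a basis of monomials, and the length is the number of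
  monomials left in the last one.
\<close>

lemma length_rees_mod_frobenius_power:
  fixes \<Delta> :: "'n::finite set set" and I :: "('n, 'k::field) mpol set"
  assumes down: "\<forall>F\<in>\<Delta>. \<forall>G\<subseteq>F. G \<in> \<Delta>" and empty: "{} \<in> \<Delta>"
    and I: "I = {f. \<forall>a. supp a \<in> \<Delta> \<longrightarrow> Poly_Mapping.lookup f a = 0}"
    and R: "R = mpol_ring Quot I"
    and \<nn>: "\<nn> = (\<lambda>f. I +>\<^bsub>mpol_ring\<^esub> f) ` (Idl\<^bsub>mpol_ring\<^esub> (range mpol_var))"
    and \<R>: "\<R> = rees_algebra R \<nn>"
    and gens: "gens = range (\<lambda>i. up_ring.monom (UP R) (I +>\<^bsub>mpol_ring\<^esub> mpol_var i) 0) \<union>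
                range (\<lambda>i. up_ring.monom (UP R) (I +>\<^bsub>mpol_ring\<^esub> mpol_var i) 1)"
    and s: "s \<ge> 1"
    and fin: "finite {(a, j). supp a \<in> \<Delta> \<and> j \<le> tdeg a \<and> \<not> frobenius_index s (a, j)}"
  shows "module_length \<R> (quotient_module \<R> (frobenius_power \<R> gens s)) =
    enat (card {(a, j). supp a \<in> \<Delta> \<and> j \<le> tdeg a \<and> \<not> frobenius_index s (a, j)})"
proof -
  let ?S = "mpol_ring :: ('n, 'k) mpol ring"
  let ?N = "{a. supp a \<notin> \<Delta>}"
  interpret S: monomial_ring ?S UNIV "\<lambda>a f. Poly_Mapping.lookup f a" Poly_Mapping.single tdeg
    by (rule monomial_ring_mpol_ring)
  have N: "S.absorbing ?N" "0 \<notin> ?N"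
    using down empty by (auto simp: S.absorbing_def supp_add)
  have I_eq: "I = S.monomial_ideal ?N"
    by (auto simp: I S.monomial_ideal_def carrier_mpol_ring)
  have I_ideal: "ideal I ?S" unfolding I_eq by (rule S.ideal_monomial_ideal[OF N(1)])
  interpret I: ideal I ?S by (rule I_ideal)
  define D where "D = {a :: 'n \<Rightarrow>\<^sub>0 nat. supp a \<in> \<Delta>}"
  have D: "UNIV - ?N = D" by (auto simp: D_def)
  define \<rho> where "\<rho> b Z = Poly_Mapping.lookup (SOME x. x \<in> Z) b" for b and Z :: "('n, 'k) mpol set"
  define \<sigma> where "\<sigma> b c = I +>\<^bsub>?S\<^esub> Poly_Mapping.single b c" for b :: "'n \<Rightarrow>\<^sub>0 nat" and c :: 'k
  interpret R: monomial_ring R D \<rho> \<sigma> tdeg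
    using S.monomial_ring_quotient(1)[OF N] unfolding D I_eq[symmetric] R[symmetric] \<rho>_def \<sigma>_def .
  have \<rho>: "\<rho> b (I +>\<^bsub>?S\<^esub> x) = Poly_Mapping.lookup x b" if "b \<in> D" for b x
    using S.monomial_ring_quotient(2)[OF N, of x b] that unfolding D I_eq[symmetric] \<rho>_def carrier_mpol_ring by simp
  have carr_R: "carrier R = (+>\<^bsub>?S\<^esub>) I ` UNIV"
    by (auto simp: R FactRing_def A_RCOSETS_def' carrier_mpol_ring)
  have \<nn>_eq: "\<nn> = R.deg_filtration 1"
  proof -
    have "R.deg_filtration 1 = {Z \<in> carrier R. \<rho> 0 Z = 0}"
    proof -
      have "1 \<le> tdeg b \<longleftrightarrow> b \<noteq> 0" for b :: "'n \<Rightarrow>\<^sub>0 nat"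
        using tdeg_eq_0_iff[of b] by linarith
      then show ?thesis using R.zero_index unfolding R.deg_filtration_def by blast
    qed
    also have "\<dots> = (+>\<^bsub>?S\<^esub>) I ` {f. Poly_Mapping.lookup f 0 = 0}"
      using \<rho>[of 0] empty by (auto simp: carr_R D_def)
    also have "{f. Poly_Mapping.lookup f 0 = 0} = Idl\<^bsub>?S\<^esub> (range mpol_var)"
      unfolding Idl_variables by simp
    finally show ?thesis using \<nn> by simp
  qed
  have split: "\<exists>b1\<in>D. \<exists>b2\<in>D. b = b1 + b2 \<and> tdeg b2 = 1" if b: "b \<in> D" "tdeg b \<noteq> 0" for b
  proof -
    have "supp b \<noteq> {}" using b by (simp add: tdeg_eq_0_iff)
    then obtain i where i: "i \<in> supp b" by blast
    have eq: "b = (b - Poly_Mapping.single i 1) + Poly_Mapping.single i 1"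
      using i diff_add_single[of 1 b i] by (simp add: in_keys_iff)
    moreover have "supp b = supp (b - Poly_Mapping.single i 1) \<union> {i}"
      using arg_cong[OF eq, of supp] by (simp add: supp_add)
    then have "b - Poly_Mapping.single i 1 \<in> D" "Poly_Mapping.single i 1 \<in> D"
      using b down by (auto simp: D_def)
    ultimately show ?thesis by (metis tdeg_single)
  qed
  define D' where "D' = {(b, j). b \<in> D \<and> j \<le> tdeg b}"
  define \<rho>' where "\<rho>' = (\<lambda>(b, j) p. \<rho> b (up_ring.coeff (UP R) p j))"
  define \<sigma>' where "\<sigma>' = (\<lambda>(b, j) c. up_ring.monom (UP R) (\<sigma> b c) j)"
  interpret Rees: monomial_ring \<R> D' \<rho>' \<sigma>' "\<lambda>(b, j). tdeg b"
    using R.monomial_ring_rees[OF split \<nn>_eq] unfolding \<R> D'_def \<rho>'_def \<sigma>'_def .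
  interpret UP: UP_cring R "UP R" by unfold_locales
  let ?E = "{b :: ('n \<Rightarrow>\<^sub>0 nat) \<times> nat. frobenius_index s b}"
  have E: "Rees.absorbing ?E" "0 \<notin> ?E"
  proof -
    show "Rees.absorbing ?E"
      unfolding Rees.absorbing_def
    proof (intro ballI impI)
      fix b1 b2 assume "b1 \<in> D'" "b2 \<in> ?E"
      obtain a1 j1 a2 j2 where b: "b1 = (a1, j1)" "b2 = (a2, j2)" by (cases b1, cases b2)
      obtain i where "s \<le> expt a2 i" "s \<le> j2 \<or> j2 + s \<le> tdeg a2"
        using \<open>b2 \<in> ?E\<close> b by (auto simp: frobenius_index_def)
      moreover have "j1 \<le> tdeg a1" using \<open>b1 \<in> D'\<close> b by (simp add: D'_def)
      ultimately have "s \<le> expt (a1 + a2) i \<and> (s \<le> j1 + j2 \<or> (j1 + j2) + s \<le> tdeg (a1 + a2))"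
        by (auto simp: lookup_add tdeg_add)
      then show "b1 + b2 \<in> ?E" unfolding b frobenius_index_def by auto
    qed
    show "0 \<notin> ?E" using s by (simp add: frobenius_index_def zero_prod_def)
  qed
  let ?G = "range (\<lambda>i. \<sigma>' (Poly_Mapping.single i s, 0) 1) \<union> range (\<lambda>i. \<sigma>' (Poly_Mapping.single i s, s) 1)"
  (* the s-th powers of the generators are again terms, with coefficient 1 *)
  have pow: "(up_ring.monom (UP R) (I +>\<^bsub>?S\<^esub> mpol_var i) n) [^]\<^bsub>\<R>\<^esub> s = \<sigma>' (Poly_Mapping.single i s, n * s) 1" for i n
  proof -
    interpret h: ring_hom_cring ?S R "(+>\<^bsub>?S\<^esub>) I"
      unfolding R by (rule I.rcos_ring_hom_cring) (rule S.is_cring)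
    have "(I +>\<^bsub>?S\<^esub> mpol_var i) [^]\<^bsub>R\<^esub> s = \<sigma> (Poly_Mapping.single i s) 1"
      unfolding \<sigma>_def mpol_var_pow[symmetric] by (rule h.hom_pow[symmetric]) (simp add: carrier_mpol_ring)
    moreover have "I +>\<^bsub>?S\<^esub> mpol_var i \<in> carrier R" by (auto simp: carr_R)
    ultimately have "(up_ring.monom (UP R) (I +>\<^bsub>?S\<^esub> mpol_var i) n) [^]\<^bsub>UP R\<^esub> s =
        \<sigma>' (Poly_Mapping.single i s, n * s) 1"
      by (simp add: UP.monom_pow \<sigma>'_def)
    then show ?thesis by (simp add: \<R> rees_algebra_def nat_pow_def)
  qed
  have "frobenius_power \<R> gens s = Idl\<^bsub>\<R>\<^esub> ?G"
    unfolding frobenius_power_def gens image_Un image_image pow by simp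
  also have "\<dots> = Rees.monomial_ideal ?E"
  proof (rule Rees.genideal_eq_monomial_ideal[OF E(1)])
    have "\<sigma>' (Poly_Mapping.single i s, n) 1 \<in> Rees.monomial_ideal ?E" if "n = 0 \<or> n = s" for i n
    proof (cases "{i} \<in> \<Delta>")
      case True
      then show ?thesis using that s
        by (intro Rees.term_in_monomial_ideal) (auto simp: D'_def D_def frobenius_index_def intro!: exI[of _ i])
    next
      case False
      (* the variable is zero in R, and so is the generator *)
      then have "Poly_Mapping.single (Poly_Mapping.single i s) 1 \<in> I"
        using s by (auto simp: I lookup_single when_def)
      then have "\<sigma> (Poly_Mapping.single i s) 1 = \<zero>\<^bsub>R\<^esub>"
        by (simp add: \<sigma>_def I.a_rcos_const R FactRing_def)
      then have "\<sigma>' (Poly_Mapping.single i s, n) 1 = \<zero>\<^bsub>\<R>\<^esub>"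
        by (simp add: \<sigma>'_def \<R> rees_algebra_def)
      then show ?thesis
        using Rees.ideal_monomial_ideal[OF E(1)] by (simp add: additive_subgroup.zero_closed ideal_def)
    qed
    then show "?G \<subseteq> Rees.monomial_ideal ?E" by auto
  next
    fix b assume b: "b \<in> D'" "b \<in> ?E"
    obtain a j where aj: "b = (a, j)" by (cases b)
    obtain i where i: "s \<le> expt a i" "s \<le> j \<or> j + s \<le> tdeg a"
      using b aj by (auto simp: frobenius_index_def)
    let ?x = "Poly_Mapping.single i s"
    have a: "a = ?x + (a - ?x)" using diff_add_single[OF i(1)] by (simp add: add.commute)
    have D: "?x \<in> D" "a - ?x \<in> D"
      using b aj down arg_cong[OF a, of supp] by (auto simp: D'_def D_def supp_add)
    have deg: "tdeg a = s + tdeg (a - ?x)" using arg_cong[OF a, of tdeg] by (simp add: tdeg_add)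
    show "\<exists>g\<in>D'. \<exists>d\<in>D'. b = g + d \<and> \<sigma>' g 1 \<in> ?G"
    proof (cases "s \<le> j")
      case True
      then show ?thesis using a b aj D deg
        by (intro bexI[of _ "(?x, s)"] bexI[of _ "(a - ?x, j - s)"]) (auto simp: D'_def)
    next
      case False
      then show ?thesis using a i D deg aj
        by (intro bexI[of _ "(?x, 0)"] bexI[of _ "(a - ?x, j)"]) (auto simp: D'_def)
    qed
  qed
  finally have J: "frobenius_power \<R> gens s = Rees.monomial_ideal ?E" .
  interpret Q: monomial_ring "\<R> Quot Rees.monomial_ideal ?E" "D' - ?E"
    "\<lambda>b Z. \<rho>' b (SOME x. x \<in> Z)" "\<lambda>b c. Rees.monomial_ideal ?E +>\<^bsub>\<R>\<^esub> \<sigma>' b c" "\<lambda>(b, j). tdeg b"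
    by (rule Rees.monomial_ring_quotient(1)[OF E])
  have DE: "D' - ?E = {(a, j). supp a \<in> \<Delta> \<and> j \<le> tdeg a \<and> \<not> frobenius_index s (a, j)}"
    by (auto simp: D'_def D_def)
  show ?thesis
    unfolding J Rees.module_length_quotient_module[OF Rees.ideal_monomial_ideal[OF E(1)]]
    using Q.chain_sup_ideals fin unfolding DE by simp
qed

theorem theorem3p5:
  fixes S :: "('n::finite, 'k::field) mpol ring"
    and P :: "nat \<Rightarrow> ('n, 'k) mpol set"
    and \<alpha> :: nat
    and d :: enat
  assumes "S = mpol_ring"
    and "\<mm> = Idl\<^bsub>S\<^esub> (range mpol_var)"
    and "\<alpha> \<ge> 2"
    and "inj_on P {1..\<alpha>}"
    and "\<And>i. i \<in> {1..\<alpha>} \<Longrightarrow> \<exists>V. P i = Idl\<^bsub>S\<^esub> (mpol_var ` V)"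
    and "I = (\<Inter>i\<in>{1..\<alpha>}. P i)"
    and "R = S Quot I"
    and "\<nn> = (\<lambda>f. I +>\<^bsub>S\<^esub> f) ` \<mm>"
    and "d = krull_dim R"
    and "cohen_macaulay R"
    and "\<R> = rees_algebra R \<nn>"
    and "gens = range (\<lambda>i. up_ring.monom (UP R) (I +>\<^bsub>S\<^esub> mpol_var i) 0) \<union>
                range (\<lambda>i. up_ring.monom (UP R) (I +>\<^bsub>S\<^esub> mpol_var i) 1)"
  shows "\<exists>Q :: rat poly. \<forall>s::nat. s \<ge> 1 \<longrightarrow>
           (\<exists>l::nat. module_length \<R> (quotient_module \<R> (frobenius_power \<R> gens s)) = enat l \<and>
                     of_nat l = poly Q (of_nat s))"
proof -
  have "\<forall>i\<in>{1..\<alpha>}. \<exists>V. P i = Idl\<^bsub>mpol_ring\<^esub> (mpol_var ` V)" using assms(1,5) by blast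
  then obtain V where V: "\<And>i. i \<in> {1..\<alpha>} \<Longrightarrow> P i = Idl\<^bsub>mpol_ring\<^esub> (mpol_var ` V i)" by metis
  (* the faces: a monomial lies outside I iff it lies outside one of the ideals P i *)
  define \<Delta> where "\<Delta> = {F. \<exists>i\<in>{1..\<alpha>}. F \<inter> V i = {}}"
  have "f \<in> I \<longleftrightarrow> (\<forall>i\<in>{1..\<alpha>}. \<forall>a. supp a \<inter> V i = {} \<longrightarrow> Poly_Mapping.lookup f a = 0)" for f
    unfolding assms(6) by (simp add: V Idl_variables)
  then have I: "I = {f. \<forall>a. supp a \<in> \<Delta> \<longrightarrow> Poly_Mapping.lookup f a = 0}"
    unfolding \<Delta>_def by blast
  have down: "\<forall>F\<in>\<Delta>. \<forall>G\<subseteq>F. G \<in> \<Delta>" unfolding \<Delta>_def by blast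
  have empty: "{} \<in> \<Delta>" using assms(3) by (auto simp: \<Delta>_def)
  obtain Q :: "rat poly" where Q: "\<forall>s::nat. s \<ge> 1 \<longrightarrow>
    finite {(a, j). supp a \<in> \<Delta> \<and> j \<le> tdeg a \<and> \<not> frobenius_index s (a, j)} \<and>
    of_nat (card {(a, j). supp a \<in> \<Delta> \<and> j \<le> tdeg a \<and> \<not> frobenius_index s (a, j)}) = poly Q (of_nat s)"
    using card_frobenius_complement_polynomial[of \<Delta>] by (rule exE)
  have "module_length \<R> (quotient_module \<R> (frobenius_power \<R> gens s)) =
      enat (card {(a, j). supp a \<in> \<Delta> \<and> j \<le> tdeg a \<and> \<not> frobenius_index s (a, j)})"
    if s: "s \<ge> 1" for s
    by (rule length_rees_mod_frobenius_power[OF down empty I assms(7)[unfolded assms(1)]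
          assms(8)[unfolded assms(2,1)] assms(11) assms(12)[unfolded assms(1)] s
          Q[rule_format, OF s, THEN conjunct1]])
  then show ?thesis using Q by blast
qed

end
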